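(* Let $G$ be a weak FI-group with a central filtration $\{G(k)\}_{k=1}^\infty$ of finite rank. If $G$ is boundedly generated, then for every $k\geq 1$ the normal weak FI-subgroup $G(k)\lhd G$ is boundedly normally generated.
   Context: $\mathrm{FI}$ is the category whose objects are finite subsets of $\mathbb{N}$ and whose morphisms are injections. For groups $A,B$, a homomorphism-modulo-conjugacy $A\to B$ is an equivalence class of homomorphisms $A\to B$ under post-composition with conjugation by elements of $B$; these compose. For finite $I\subset J\subset\mathbb{N}$, $i_I^J$ denotes the inclusion. A weak FI-group $G$ consists of: (i) a group $G_I$ for each finite $I\subset\mathbb{N}$; (ii) for each injection $f\colon I\hookrightarrow J$ a homomorphism-modulo-conjugacy $G_f\colon G_I\to G_J$ with $G_{\mathrm{id}_I}=\mathrm{id}$ and $G_{g\circ f}=G_g\circ G_f$ modulo conjugacy; (iii) for each pair $I\subset J$ an actual homomorphism $G_I^J\colon G_I\to G_J$ representing $G_{i_I^J}$, with $G_J^K\circ G_I^J=G_I^K$ for $I\subset J\subset K$. A normal weak FI-subgroup $H\lhd G$ is a choice of normal subgroup $H_I\lhd G_I$ for each $I$ such that $G_f(H_I)\subset H_J$ for every injection $f\colon I\hookrightarrow J$ (well defined since $H_I$ is normal). For $I\subset J$ and $H\lhd G$ set $H_J(I)=G_I^J(H_I)\subset H_J$. $G$ is boundedly generated (in degree $A$) if for every finite $J$, $G_J$ is generated by the subgroups $G_J(I)$ with $I\subset J$, $|I|\leq A$. $H\lhd G$ is boundedly normally generated (in degree $B$) if for every finite $J$, $H_J$ is generated by the $G_J$-conjugates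 of the subgroups $H_J(I)$ with $I\subset J$, $|I|\leq B$. A central filtration of $G$ is a sequence of normal weak FI-subgroups $G=G(1)\supset G(2)\supset\cdots$ (inclusions meaning $G(k+1)_I\subset G(k)_I$ for all $I$) with $[G_I,G(k)_I]\subset G(k+1)_I$ for all $k$ and $I$; it has finite rank if each abelian group $G(k)_I/G(k+1)_I$ is finitely generated. *)

theory Defs
  imports "HOL-Algebra.Algebra"
begin

text \<open>An injection f of the finite set I into the finite set J, represented by a
function nat \<Rightarrow> nat whose values outside I are irrelevant.\<close>
definition FI_inj :: "nat set \<Rightarrow> nat set \<Rightarrow> (nat \<Rightarrow> nat) \<Rightarrow> bool" where
  "FI_inj I J f \<longleftrightarrow> finite I \<and> finite J \<and> inj_on f I \<and> f ` I \<subseteq> J"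

definition conj_equiv ::
  "('a, 'b) monoid_scheme \<Rightarrow> ('c, 'd) monoid_scheme \<Rightarrow> ('a \<Rightarrow> 'c) \<Rightarrow> ('a \<Rightarrow> 'c) \<Rightarrow> bool" where
  "conj_equiv A B phi psi \<longleftrightarrow>
     (\<exists>b \<in> carrier B. \<forall>x \<in> carrier A. phi x = b \<otimes>\<^bsub>B\<^esub> psi x \<otimes>\<^bsub>B\<^esub> inv\<^bsub>B\<^esub> b)"

text \<open>Weak FI-group: groups G I (for finite I), representatives Gf I J f of the
homomorphisms-modulo-conjugacy G_f, and actual homomorphisms Ginc I J = G_I^J.\<close>
definition weak_FI_group ::
  "(nat set \<Rightarrow> 'a monoid) \<Rightarrow> (nat set \<Rightarrow> nat set \<Rightarrow> (nat \<Rightarrow> nat) \<Rightarrow> 'a \<Rightarrow> 'a)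
     \<Rightarrow> (nat set \<Rightarrow> nat set \<Rightarrow> 'a \<Rightarrow> 'a) \<Rightarrow> bool" where
  "weak_FI_group G Gf Ginc \<longleftrightarrow>
     (\<forall>I. finite I \<longrightarrow> group (G I)) \<and>
     (\<forall>I J f. FI_inj I J f \<longrightarrow> Gf I J f \<in> hom (G I) (G J)) \<and>
     \<comment> \<open>G_f depends only on the injection f : I \<rightarrow> J (modulo conjugacy)\<close>
     (\<forall>I J f f'. FI_inj I J f \<longrightarrow> FI_inj I J f' \<longrightarrow> (\<forall>i\<in>I. f i = f' i) \<longrightarrow>
        conj_equiv (G I) (G J) (Gf I J f) (Gf I J f')) \<and>
     \<comment> \<open>G_id = id modulo conjugacy\<close>
     (\<forall>I. finite I \<longrightarrow> conj_equiv (G I) (G I) (Gf I I id) id) \<and>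
     \<comment> \<open>G_{g o f} = G_g o G_f modulo conjugacy\<close>
     (\<forall>I J K f g. FI_inj I J f \<longrightarrow> FI_inj J K g \<longrightarrow>
        conj_equiv (G I) (G K) (Gf I K (g \<circ> f)) (Gf J K g \<circ> Gf I J f)) \<and>
     \<comment> \<open>G_I^J is an actual homomorphism representing G_{i_I^J}\<close>
     (\<forall>I J. finite J \<longrightarrow> I \<subseteq> J \<longrightarrow>
        Ginc I J \<in> hom (G I) (G J) \<and> conj_equiv (G I) (G J) (Ginc I J) (Gf I J id)) \<and>
     (\<forall>I J K x. finite K \<longrightarrow> I \<subseteq> J \<longrightarrow> J \<subseteq> K \<longrightarrow> x \<in> carrier (G I) \<longrightarrow>
        Ginc J K (Ginc I J x) = Ginc I K x)"

definition normal_weak_FI_subgroup ::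
  "(nat set \<Rightarrow> 'a set) \<Rightarrow> (nat set \<Rightarrow> 'a monoid) \<Rightarrow> (nat set \<Rightarrow> nat set \<Rightarrow> (nat \<Rightarrow> nat) \<Rightarrow> 'a \<Rightarrow> 'a)
     \<Rightarrow> bool" where
  "normal_weak_FI_subgroup H G Gf \<longleftrightarrow>
     (\<forall>I. finite I \<longrightarrow> H I \<lhd> G I) \<and>
     (\<forall>I J f. FI_inj I J f \<longrightarrow> Gf I J f ` H I \<subseteq> H J)"

definition sub_at :: "(nat set \<Rightarrow> nat set \<Rightarrow> 'a \<Rightarrow> 'a) \<Rightarrow> (nat set \<Rightarrow> 'a set) \<Rightarrow> nat set \<Rightarrow> nat set \<Rightarrow> 'a set" where
  "sub_at Ginc H J I = Ginc I J ` H I"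

definition boundedly_generated ::
  "(nat set \<Rightarrow> 'a monoid) \<Rightarrow> (nat set \<Rightarrow> nat set \<Rightarrow> 'a \<Rightarrow> 'a) \<Rightarrow> nat \<Rightarrow> bool" where
  "boundedly_generated G Ginc A \<longleftrightarrow>
     (\<forall>J. finite J \<longrightarrow>
        carrier (G J) = generate (G J)
          (\<Union> {sub_at Ginc (\<lambda>I. carrier (G I)) J I | I. I \<subseteq> J \<and> card I \<le> A}))"

definition boundedly_normally_generated ::
  "(nat set \<Rightarrow> 'a set) \<Rightarrow> (nat set \<Rightarrow> 'a monoid) \<Rightarrow> (nat set \<Rightarrow> nat set \<Rightarrow> 'a \<Rightarrow> 'a) \<Rightarrow> nat \<Rightarrow> bool" where
  "boundedly_normally_generated H G Ginc B \<longleftrightarrow>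
     (\<forall>J. finite J \<longrightarrow>
        H J = generate (G J)
          {g \<otimes>\<^bsub>G J\<^esub> h \<otimes>\<^bsub>G J\<^esub> inv\<^bsub>G J\<^esub> g | g h I.
             g \<in> carrier (G J) \<and> I \<subseteq> J \<and> card I \<le> B \<and> h \<in> sub_at Ginc H J I})"

definition commutator_subgroup :: "('a, 'b) monoid_scheme \<Rightarrow> 'a set \<Rightarrow> 'a set \<Rightarrow> 'a set" where
  "commutator_subgroup G A B =
     generate G {a \<otimes>\<^bsub>G\<^esub> b \<otimes>\<^bsub>G\<^esub> inv\<^bsub>G\<^esub> a \<otimes>\<^bsub>G\<^esub> inv\<^bsub>G\<^esub> b | a b. a \<in> A \<and> b \<in> B}"

definition finitely_generated_group :: "('a, 'b) monoid_scheme \<Rightarrow> bool" where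
  "finitely_generated_group Q \<longleftrightarrow>
     (\<exists>S. finite S \<and> S \<subseteq> carrier Q \<and> generate Q S = carrier Q)"

definition central_filtration ::
  "(nat \<Rightarrow> nat set \<Rightarrow> 'a set) \<Rightarrow> (nat set \<Rightarrow> 'a monoid)
     \<Rightarrow> (nat set \<Rightarrow> nat set \<Rightarrow> (nat \<Rightarrow> nat) \<Rightarrow> 'a \<Rightarrow> 'a) \<Rightarrow> bool" where
  "central_filtration F G Gf \<longleftrightarrow>
     (\<forall>I. finite I \<longrightarrow> F 1 I = carrier (G I)) \<and>
     (\<forall>k \<ge> 1. normal_weak_FI_subgroup (F k) G Gf) \<and>
     (\<forall>k \<ge> 1. \<forall>I. finite I \<longrightarrow> F (Suc k) I \<subseteq> F k I) \<and>
     (\<forall>k \<ge> 1. \<forall>I. finite I \<longrightarrow>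
        commutator_subgroup (G I) (carrier (G I)) (F k I) \<subseteq> F (Suc k) I)"

definition finite_rank_filtration ::
  "(nat \<Rightarrow> nat set \<Rightarrow> 'a set) \<Rightarrow> (nat set \<Rightarrow> 'a monoid) \<Rightarrow> bool" where
  "finite_rank_filtration F G \<longleftrightarrow>
     (\<forall>k \<ge> 1. \<forall>I. finite I \<longrightarrow>
        finitely_generated_group (((G I)\<lparr>carrier := F k I\<rparr>) Mod (F (Suc k) I)))"

end

theory Submission
  imports Defs "HOL-Library.List_Lexorder"
begin

text \<open>Induction on k. Suppose G is generated in degree A and H = G(k) is normally generated in
degree B, and let N be the part of H' = G(k+1) normally generated in degree A + B. Then
[G, H] is contained in N, so H/N is an honest FI-module; it is generated in degree B, and it is
finitely generated since it agrees with H/H' in degrees up to A + B. FI-modules over the integers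
are Noetherian, so its submodule H'/N is generated in bounded degree.

Noetherianity is proved by Groebner bases for the action of order-preserving injections: the
monomials are injections of a fixed initial segment, they are determined up to this action by the
gaps between their values, and Dickson's lemma applies to the gaps.\<close>

section \<open>Dickson's lemma and Groebner bases over the integers\<close>

text \<open>Generators of H/H' alone give no bound for H': what must be bounded are the relations
  among them. Hence H is divided by N, the part of H' already accounted for, and Noetherianity is
  applied to the kernel H'/N of H/N -> H/H'. The laws of G hold only up to conjugacy by elements of
  G_J. Conjugation changes an element of H by a commutator in [G, H], so dividing by N turns
  conjugacy into equality. Finite rank enters through small sets: if |I| is at most A + B, then N_I
  = H'_I, so (H/N)_I is the finitely generated group (H/H')_I.

  In the Groebner argument, a permutation that moves monomials cannot preserve a total order on the
  finite set of them, which is why only order-preserving injections may act. The price is that one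
  generator yields a monomial for every injection of the initial segment. The monomials need not be
  linearly independent in the module, so leading coefficients are taken over all expressions of an
  element.\<close>

lemma mono_subseq_nat:
  fixes s :: "nat \<Rightarrow> nat"
  shows "\<exists>\<sigma>. strict_mono \<sigma> \<and> incseq (\<lambda>n. s (\<sigma> n))"
proof -
  obtain f where f: "strict_mono f" "monoseq (\<lambda>n. s (f n))"
    using seq_monosub by blast
  show ?thesis
  proof (cases "incseq (\<lambda>n. s (f n))")
    case True
    with f show ?thesis by blast
  next
    case False
    with f(2) have dec: "\<And>m n. m \<le> n \<Longrightarrow> s (f n) \<le> s (f m)"
      by (auto simp: monoseq_def incseq_def)
    \<comment> \<open>A decreasing sequence of naturals is constant once it has reached its least
      value, so a tail of it is increasing too.\<close>
    define v where "v = (LEAST v. v \<in> range (\<lambda>n. s (f n)))"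
    have "v \<in> range (\<lambda>n. s (f n))"
      unfolding v_def by (rule LeastI[of _ "s (f 0)"]) auto
    then obtain N where N: "v = s (f N)" by auto
    have "v \<le> s (f n)" for n
      unfolding v_def by (rule Least_le) auto
    with dec N have "s (f (N + n)) = v" for n
      by (metis le_add1 le_antisym)
    moreover have "strict_mono (\<lambda>n. f (N + n))"
      using f(1) by (simp add: strict_mono_def)
    ultimately show ?thesis
      by (intro exI[of _ "\<lambda>n. f (N + n)"]) (simp add: incseq_def)
  qed
qed

text \<open>Each coordinate is made monotone by one more passage to a subsequence, which keeps the
  earlier coordinates monotone. Taking a set of sequences as the coordinates allows any numerical
  data of a sequence of objects to be listed among them.\<close>

lemma dickson_subseq:
  fixes C :: "(nat \<Rightarrow> nat) set"
  assumes "finite C"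
  shows "\<exists>\<sigma>. strict_mono \<sigma> \<and> (\<forall>c\<in>C. incseq (\<lambda>n. c (\<sigma> n)))"
  using assms
proof (induction C)
  case empty
  show ?case by (meson empty_iff strict_mono_id)
next
  case (insert c C)
  then obtain \<sigma> where \<sigma>: "strict_mono \<sigma>" "\<forall>c\<in>C. incseq (\<lambda>n. c (\<sigma> n))" by blast
  obtain \<tau> where \<tau>: "strict_mono \<tau>" "incseq (\<lambda>n. c (\<sigma> (\<tau> n)))"
    using mono_subseq_nat[of "\<lambda>n. c (\<sigma> n)"] by blast
  have "strict_mono (\<lambda>n. \<sigma> (\<tau> n))" using \<sigma>(1) \<tau>(1) by (simp add: strict_mono_def)
  moreover have "incseq (\<lambda>n. c' (\<sigma> (\<tau> n)))" if "c' \<in> C" for c'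
    using \<sigma>(2) that strict_mono_mono[OF \<tau>(1)] by (simp add: incseq_def)
  ultimately show ?case
    using \<tau>(2) by (intro exI[of _ "\<lambda>n. \<sigma> (\<tau> n)"]) blast
qed

section \<open>Leading coefficients over the integers\<close>

text \<open>Dividing an element of \<open>S'\<close> by the least positive element of
  \<open>S\<close> leaves a remainder in \<open>S'\<close> that is too small to be positive. Thus a
  growing ideal of leading coefficients is unchanged as soon as its generator does not decrease, and
  the ascending chain condition becomes one more coordinate for Dickson's lemma. The
  \<open>LEAST\<close> of the zero subgroup is unspecified, hence \<open>nz\<close>.\<close>

lemma int_subgroup_eqI:
  fixes S S' :: "int set"
  assumes diff: "\<And>a b. a \<in> S \<Longrightarrow> b \<in> S \<Longrightarrow> a - b \<in> S"
    and diff': "\<And>a b. a \<in> S' \<Longrightarrow> b \<in> S' \<Longrightarrow> a - b \<in> S'"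
    and sub: "S \<subseteq> S'" and nz: "\<exists>a\<in>S. a \<noteq> 0"
    and le: "(LEAST d. 0 < d \<and> int d \<in> S) \<le> (LEAST d. 0 < d \<and> int d \<in> S')"
  shows "S = S'"
proof -
  obtain a where a: "a \<in> S" "a \<noteq> 0" using nz by blast
  have zero: "0 \<in> S" "0 \<in> S'" using diff[OF a(1) a(1)] sub by auto
  have neg: "- b \<in> S" if "b \<in> S" for b using diff[OF zero(1) that] by simp
  have pos: "0 < nat \<bar>a\<bar> \<and> int (nat \<bar>a\<bar>) \<in> S" using a neg by (auto simp: abs_if)
  define d where "d = (LEAST d. 0 < d \<and> int d \<in> S)"
  have d: "0 < d" "int d \<in> S"
    using LeastI[of "\<lambda>d. 0 < d \<and> int d \<in> S", OF pos] unfolding d_def by auto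
  have mult_nat: "int n * b \<in> U"
    if "0 \<in> U" "\<And>a b. a \<in> U \<Longrightarrow> b \<in> U \<Longrightarrow> a - b \<in> U" "b \<in> U" for n b and U :: "int set"
  proof (induction n)
    case 0
    then show ?case using that by simp
  next
    case (Suc n)
    have "int n * b - (0 - b) \<in> U" using that Suc by blast
    then show ?case by (simp add: algebra_simps)
  qed
  have mult: "c * b \<in> U"
    if "0 \<in> U" "\<And>a b. a \<in> U \<Longrightarrow> b \<in> U \<Longrightarrow> a - b \<in> U" "b \<in> U" for c b and U :: "int set"
  proof (cases "0 \<le> c")
    case True
    then show ?thesis using mult_nat[OF that, of "nat c"] by simp
  next
    case False
    have "0 - int (nat (- c)) * b \<in> U" using that mult_nat[OF that, of "nat (- c)"] by blast
    then show ?thesis using False by simp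
  qed
  have "x \<in> S" if x: "x \<in> S'" for x
  proof -
    have "x - (x div int d) * int d \<in> S'"
      using diff' x mult[OF zero(2) diff'] sub d(2) by blast
    then have r: "x mod int d \<in> S'" by (simp add: minus_div_mult_eq_mod)
    have "x mod int d = 0"
    proof (rule ccontr)
      assume "x mod int d \<noteq> 0"
      moreover have "0 \<le> x mod int d" "x mod int d < int d" using d(1) by simp_all
      ultimately have "0 < nat (x mod int d) \<and> int (nat (x mod int d)) \<in> S'" "nat (x mod int d) < d"
        using r by auto
      then have "(LEAST d. 0 < d \<and> int d \<in> S') < d"
        using Least_le[of "\<lambda>d. 0 < d \<and> int d \<in> S'"] by (meson order_le_less_trans)
      with le show False by (simp add: d_def)
    qed
    then have "x = (x div int d) * int d" by (metis add.right_neutral div_mult_mod_eq)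
    then show ?thesis using mult[OF zero(1) diff d(2)] by metis
  qed
  with sub show ?thesis by blast
qed

text \<open>Commutativity lets all powers of \<open>b\<close> be collected in front. Later
  \<open>b\<close> is the largest monomial of an element, \<open>a\<close> its coefficient and
  \<open>w\<close> the tail.\<close>

lemma (in comm_group) generate_insertE:
  assumes "y \<in> generate G (insert b S)" "b \<in> carrier G" "S \<subseteq> carrier G"
  obtains a :: int and w where "w \<in> generate G S" "y = b [^] a \<otimes> w"
proof -
  have "\<exists>(a::int) w. w \<in> generate G S \<and> y = b [^] a \<otimes> w"
    using assms(1)
  proof (induction rule: generate.induct)
    case one
    have "\<one> = b [^] (0::int) \<otimes> \<one>" by simp
    then show ?case using generate.one by (intro exI conjI)
  next
    case (incl h)
    then consider "h = b" | "h \<in> S" by blast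
    then show ?case
    proof cases
      case 1
      have "h = b [^] (1::int) \<otimes> \<one>" using assms 1 by (simp add: int_pow_1)
      then show ?thesis using generate.one by (intro exI conjI)
    next
      case 2
      have "h = b [^] (0::int) \<otimes> h" using assms 2 by auto
      then show ?thesis using generate.incl[OF 2] by (intro exI conjI)
    qed
  next
    case (inv h)
    then consider "h = b" | "h \<in> S" by blast
    then show ?case
    proof cases
      case 1
      have "inv h = b [^] (-1::int) \<otimes> \<one>"
        using assms 1 int_pow_neg[of b 1] by (simp add: int_pow_1)
      then show ?thesis using generate.one by (intro exI conjI)
    next
      case 2
      have "inv h = b [^] (0::int) \<otimes> inv h" using assms 2 by auto
      then show ?thesis using generate.inv[OF 2] by (intro exI conjI)
    qed
  next
    case (eng h1 h2)
    then obtain a1 w1 a2 w2 where w: "w1 \<in> generate G S" "h1 = b [^] (a1::int) \<otimes> w1"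
      "w2 \<in> generate G S" "h2 = b [^] (a2::int) \<otimes> w2" by blast
    have c: "w1 \<in> carrier G" "w2 \<in> carrier G" using w assms(3) generate_in_carrier by blast+
    have "h1 \<otimes> h2 = b [^] (a1 + a2) \<otimes> (w1 \<otimes> w2)"
      using assms(2) c w by (simp add: int_pow_mult m_ac)
    then show ?case using generate.eng[OF w(1,3)] by (intro exI conjI)
  qed
  then show ?thesis using that by blast
qed

text \<open>One reduction step: two elements with the same leading term \<open>p\<close> differ by
  the difference of their tails.\<close>

lemma (in comm_group) mult_cancel_inv:
  assumes "p \<in> carrier G" "w \<in> carrier G" "t \<in> carrier G"
  shows "(p \<otimes> w) \<otimes> inv (p \<otimes> t) = w \<otimes> inv t"
proof -
  have "(p \<otimes> w) \<otimes> inv (p \<otimes> t) = w \<otimes> (p \<otimes> (inv p \<otimes> inv t))"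
    unfolding inv_mult[OF assms(1,3)] m_comm[OF assms(1,2)] using assms by (simp add: m_assoc)
  also have "p \<otimes> (inv p \<otimes> inv t) = inv t"
    using assms m_assoc[of p "inv p" "inv t"] by simp
  finally show ?thesis .
qed

lemma strict_mono_dominates:
  fixes \<sigma> :: "nat \<Rightarrow> nat"
  assumes "strict_mono \<sigma>"
  obtains j where "0 < j" "N \<le> \<sigma> j"
  using strict_mono_imp_increasing[OF assms, of "Suc N"] that[of "Suc N"] by simp

text \<open>A Groebner basis argument over the integers: the I n u below is the ideal of leading
coefficients, at the monomial u, of the elements of K n.\<close>
lemma bounded_generation_of_wqo:
  fixes W :: "nat \<Rightarrow> 'b monoid" and E :: "nat \<Rightarrow> 'i::linorder set" and e :: "nat \<Rightarrow> 'i \<Rightarrow> 'b"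
    and M :: "nat \<Rightarrow> nat \<Rightarrow> 'f set" and act :: "'f \<Rightarrow> 'i \<Rightarrow> 'i"
    and T :: "nat \<Rightarrow> nat \<Rightarrow> 'f \<Rightarrow> 'b \<Rightarrow> 'b" and K :: "nat \<Rightarrow> 'b set"
  assumes comm: "\<And>n. comm_group (W n)"
    and finX: "\<And>n. finite (E n)"
    and e_in: "\<And>n u. u \<in> E n \<Longrightarrow> e n u \<in> carrier (W n)"
    and T_hom: "\<And>m n f. f \<in> M m n \<Longrightarrow> T m n f \<in> hom (W m) (W n)"
    and act_in: "\<And>m n f u. f \<in> M m n \<Longrightarrow> u \<in> E m \<Longrightarrow> act f u \<in> E n"
    and act_less: "\<And>m n f u v. f \<in> M m n \<Longrightarrow> u \<in> E m \<Longrightarrow> v \<in> E m \<Longrightarrow> u < v \<Longrightarrow> act f u < act f v"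
    and T_e: "\<And>m n f u. f \<in> M m n \<Longrightarrow> u \<in> E m \<Longrightarrow> T m n f (e m u) = e n (act f u)"
    and wqo: "\<And>(l :: nat \<Rightarrow> nat) (u :: nat \<Rightarrow> 'i) (d :: nat \<Rightarrow> nat). (\<And>i. u i \<in> E (l i)) \<Longrightarrow>
      \<exists>\<sigma> :: nat \<Rightarrow> nat. strict_mono \<sigma> \<and> (\<forall>i j. i < j \<longrightarrow> d (\<sigma> i) \<le> d (\<sigma> j) \<and>
        (\<exists>f \<in> M (l (\<sigma> i)) (l (\<sigma> j)). act f (u (\<sigma> i)) = u (\<sigma> j)))"
    and K_sub: "\<And>n. subgroup (K n) (W n)"
    and T_K: "\<And>m n f. f \<in> M m n \<Longrightarrow> T m n f ` K m \<subseteq> K n"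
  shows "\<exists>D. \<forall>n. K n \<inter> generate (W n) (e n ` E n)
    \<subseteq> generate (W n) (\<Union>{T m n f ` K m | m f. m \<le> D \<and> f \<in> M m n})"
proof -
  \<comment> \<open>\<open>L n b\<close> holds the possible tails below \<open>b\<close>. Because of
    relations among the monomials an element may have several leading terms; \<open>I n b\<close>
    admits every expression with leading monomial \<open>b\<close>, which amounts to working in the
    preimage of \<open>K n\<close> in the free abelian group on \<open>E n\<close>.\<close>
  define L where "L n b = generate (W n) (e n ` {v \<in> E n. v < b})" for n b
  define I where "I n b = {a::int. \<exists>w \<in> L n b. e n b [^]\<^bsub>W n\<^esub> a \<otimes>\<^bsub>W n\<^esub> w \<in> K n}" for n b
  have L_carrier: "L n b \<subseteq> carrier (W n)" for n b
  proof -
    interpret comm_group "W n" by (rule comm)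
    show ?thesis unfolding L_def by (rule generate_incl) (use e_in in auto)
  qed
  have L_sub: "subgroup (L n b) (W n)" for n b
  proof -
    interpret comm_group "W n" by (rule comm)
    show ?thesis unfolding L_def by (rule generate_is_subgroup) (use e_in in auto)
  qed
  have I_diff: "a - b \<in> I n u" if u: "u \<in> E n" and ab: "a \<in> I n u" "b \<in> I n u" for a b n u
  proof -
    interpret comm_group "W n" by (rule comm)
    obtain w w' where w: "w \<in> L n u" "e n u [^]\<^bsub>W n\<^esub> a \<otimes>\<^bsub>W n\<^esub> w \<in> K n"
      "w' \<in> L n u" "e n u [^]\<^bsub>W n\<^esub> b \<otimes>\<^bsub>W n\<^esub> w' \<in> K n"
      using ab unfolding I_def by blast
    have c: "w \<in> carrier (W n)" "w' \<in> carrier (W n)" using w L_carrier by blast+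
    note eu = e_in[OF u]
    have "(e n u [^]\<^bsub>W n\<^esub> a \<otimes>\<^bsub>W n\<^esub> w) \<otimes>\<^bsub>W n\<^esub> inv\<^bsub>W n\<^esub> (e n u [^]\<^bsub>W n\<^esub> b \<otimes>\<^bsub>W n\<^esub> w') \<in> K n"
      by (intro subgroup.m_closed[OF K_sub] subgroup.m_inv_closed[OF K_sub] w)
    also have "(e n u [^]\<^bsub>W n\<^esub> a \<otimes>\<^bsub>W n\<^esub> w) \<otimes>\<^bsub>W n\<^esub> inv\<^bsub>W n\<^esub> (e n u [^]\<^bsub>W n\<^esub> b \<otimes>\<^bsub>W n\<^esub> w')
      = e n u [^]\<^bsub>W n\<^esub> (a - b) \<otimes>\<^bsub>W n\<^esub> (w \<otimes>\<^bsub>W n\<^esub> inv\<^bsub>W n\<^esub> w')"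
      using c eu by (simp add: inv_mult int_pow_diff m_ac)
    finally have *: "e n u [^]\<^bsub>W n\<^esub> (a - b) \<otimes>\<^bsub>W n\<^esub> (w \<otimes>\<^bsub>W n\<^esub> inv\<^bsub>W n\<^esub> w') \<in> K n" .
    have "w \<otimes>\<^bsub>W n\<^esub> inv\<^bsub>W n\<^esub> w' \<in> L n u"
      by (intro subgroup.m_closed[OF L_sub] subgroup.m_inv_closed[OF L_sub] w)
    with * show ?thesis unfolding I_def by blast
  qed
  \<comment> \<open>Here the monotonicity \<open>act_less\<close> is used: tails go to tails, so a
    leading term is carried to a leading term and the ideals \<open>I\<close> can only grow along
    \<open>act\<close>.\<close>
  have T_L: "T m n f w \<in> L n (act f u)"
    if f: "f \<in> M m n" and u: "u \<in> E m" and w: "w \<in> L m u" for m n f u w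
  proof -
    interpret group_hom "W m" "W n" "T m n f"
      using comm T_hom[OF f] by (simp add: group_hom_def group_hom_axioms_def comm_group.axioms)
    have "T m n f ` L m u = generate (W n) (T m n f ` e m ` {v \<in> E m. v < u})"
      unfolding L_def by (rule generate_img[symmetric]) (use e_in in auto)
    also have "\<dots> \<subseteq> L n (act f u)"
      unfolding L_def
    proof (rule H.mono_generate)
      show "T m n f ` e m ` {v \<in> E m. v < u} \<subseteq> e n ` {v \<in> E n. v < act f u}"
        using act_in[OF f] act_less[OF f _ u] T_e[OF f] by auto
    qed
    finally show ?thesis using w by blast
  qed
  have T_pow: "T m n f (e m u [^]\<^bsub>W m\<^esub> a \<otimes>\<^bsub>W m\<^esub> w) = e n (act f u) [^]\<^bsub>W n\<^esub> a \<otimes>\<^bsub>W n\<^esub> T m n f w"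
    if f: "f \<in> M m n" and u: "u \<in> E m" and w: "w \<in> L m u" for m n f u w and a :: int
  proof -
    interpret group_hom "W m" "W n" "T m n f"
      using comm T_hom[OF f] by (simp add: group_hom_def group_hom_axioms_def comm_group.axioms)
    have "w \<in> carrier (W m)" using w L_carrier by blast
    then show ?thesis using e_in[OF u] T_e[OF f u] by (simp add: hom_int_pow)
  qed
  have I_mono: "I m u \<subseteq> I n (act f u)" if f: "f \<in> M m n" and u: "u \<in> E m" for m n f u
  proof
    fix a assume "a \<in> I m u"
    then obtain w where w: "w \<in> L m u" "e m u [^]\<^bsub>W m\<^esub> a \<otimes>\<^bsub>W m\<^esub> w \<in> K m"
      unfolding I_def by blast
    have "T m n f (e m u [^]\<^bsub>W m\<^esub> a \<otimes>\<^bsub>W m\<^esub> w) \<in> K n"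
      using T_K[OF f] w(2) by blast
    then show "a \<in> I n (act f u)"
      unfolding I_def T_pow[OF f u w(1)] using T_L[OF f u w(1)] by blast
  qed
  \<comment> \<open>Otherwise every \<open>D\<close> has a counterexample, a monomial
    \<open>u D\<close> in degree \<open>l D\<close>, and these form a sequence indexed by
    \<open>D\<close> itself. The well-quasi-order is applied with the generators \<open>d\<close> of
    the leading ideals as an additional coordinate.\<close>
  have "\<exists>D. \<forall>n u. u \<in> E n \<longrightarrow> (\<exists>a\<in>I n u. a \<noteq> 0) \<longrightarrow>
    (\<exists>m\<le>D. \<exists>u0\<in>E m. \<exists>f\<in>M m n. act f u0 = u \<and> I m u0 = I n u)"
  proof (rule ccontr)
    assume "\<not> ?thesis"
    then have "\<forall>D. \<exists>n u. u \<in> E n \<and> (\<exists>a\<in>I n u. a \<noteq> 0) \<and>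
      \<not> (\<exists>m\<le>D. \<exists>u0\<in>E m. \<exists>f\<in>M m n. act f u0 = u \<and> I m u0 = I n u)"
      by blast
    from choice[OF this] obtain l where "\<forall>D. \<exists>u. u \<in> E (l D) \<and> (\<exists>a\<in>I (l D) u. a \<noteq> 0) \<and>
      \<not> (\<exists>m\<le>D. \<exists>u0\<in>E m. \<exists>f\<in>M m (l D). act f u0 = u \<and> I m u0 = I (l D) u)" ..
    from choice[OF this] obtain u where lu: "\<And>D. u D \<in> E (l D)" "\<And>D. \<exists>a\<in>I (l D) (u D). a \<noteq> 0"
      "\<And>D. \<not> (\<exists>m\<le>D. \<exists>u0\<in>E m. \<exists>f\<in>M m (l D). act f u0 = u D \<and> I m u0 = I (l D) (u D))"
      by blast
    define d where "d i = (LEAST d. 0 < d \<and> int d \<in> I (l i) (u i))" for i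
    from wqo[where u = u and l = l and d = d, OF lu(1)]
    obtain \<sigma> :: "nat \<Rightarrow> nat" where \<sigma>: "strict_mono \<sigma>" and \<sigma>_le: "\<forall>i j. i < j \<longrightarrow> d (\<sigma> i) \<le> d (\<sigma> j) \<and>
      (\<exists>f \<in> M (l (\<sigma> i)) (l (\<sigma> j)). act f (u (\<sigma> i)) = u (\<sigma> j))" by blast
    \<comment> \<open>The counterexample with index \<open>\<sigma> j\<close> cannot be reached from
      any degree up to \<open>\<sigma> j\<close>. So \<open>j\<close> is taken large enough for the
      degree of the first term of the subsequence to be among these.\<close>
    obtain j where j: "0 < j" "l (\<sigma> 0) \<le> \<sigma> j"
      using strict_mono_dominates[OF \<sigma>] by blast
    obtain f where f: "f \<in> M (l (\<sigma> 0)) (l (\<sigma> j))" "act f (u (\<sigma> 0)) = u (\<sigma> j)"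
      using \<sigma>_le j(1) by blast
    have "I (l (\<sigma> 0)) (u (\<sigma> 0)) = I (l (\<sigma> j)) (u (\<sigma> j))"
    proof (rule int_subgroup_eqI)
      show "I (l (\<sigma> 0)) (u (\<sigma> 0)) \<subseteq> I (l (\<sigma> j)) (u (\<sigma> j))"
        using I_mono[OF f(1) lu(1)] f(2) by simp
      show "(LEAST d. 0 < d \<and> int d \<in> I (l (\<sigma> 0)) (u (\<sigma> 0)))
        \<le> (LEAST d. 0 < d \<and> int d \<in> I (l (\<sigma> j)) (u (\<sigma> j)))"
        using \<sigma>_le j(1) unfolding d_def by blast
    qed (use I_diff lu in blast)+
    with lu(3)[of "\<sigma> j"] j(2) f lu(1) show False by blast
  qed
  then obtain D where D: "\<And>n u. u \<in> E n \<Longrightarrow> (\<exists>a\<in>I n u. a \<noteq> 0) \<Longrightarrow>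
    (\<exists>m\<le>D. \<exists>u0\<in>E m. \<exists>f\<in>M m n. act f u0 = u \<and> I m u0 = I n u)"
    by blast
  have "K n \<inter> generate (W n) (e n ` E n)
    \<subseteq> generate (W n) (\<Union>{T m n f ` K m | m f. m \<le> D \<and> f \<in> M m n})" (is "_ \<subseteq> ?P") for n
  proof -
    interpret comm_group "W n" by (rule comm)
    have TK_carrier: "\<Union>{T m n f ` K m | m f. m \<le> D \<and> f \<in> M m n} \<subseteq> carrier (W n)"
      using T_K subgroup.subset[OF K_sub] by blast
    have P_sub: "subgroup ?P (W n)" by (rule generate_is_subgroup[OF TK_carrier])
    \<comment> \<open>The induction runs over the initial segments of the ordered set
      \<open>E n\<close>. Removing the largest monomial \<open>b\<close> from one leaves exactly the
      monomials below \<open>b\<close>, whose span is \<open>L n b\<close>.\<close>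
    have "K n \<inter> generate (W n) (e n ` S) \<subseteq> ?P"
      if "S \<subseteq> E n" "\<And>u v. v \<in> S \<Longrightarrow> u \<in> E n \<Longrightarrow> u < v \<Longrightarrow> u \<in> S" for S
    proof -
      have "finite S" using that(1) finX finite_subset by blast
      then show ?thesis using that
      proof (induction rule: finite_linorder_max_induct)
        case empty
        then show ?case by (auto simp: generate_empty generate.one)
      next
        case (insert b A)
        have b: "b \<in> E n" using insert.prems(1) by simp
        have A: "A = {v \<in> E n. v < b}"
        proof (intro equalityI subsetI)
          show "v \<in> {v \<in> E n. v < b}" if "v \<in> A" for v
            using that insert.hyps(2) insert.prems(1) by auto
          show "v \<in> A" if "v \<in> {v \<in> E n. v < b}" for v
            using that insert.prems(2)[of b v] by auto
        qed
        then have L: "L n b = generate (W n) (e n ` A)" by (simp add: L_def)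
        have IH: "K n \<inter> L n b \<subseteq> ?P"
          unfolding L
        proof (rule insert.IH)
          show "A \<subseteq> E n" using insert.prems(1) by simp
          show "u \<in> A" if "v \<in> A" "u \<in> E n" "u < v" for u v
            using that unfolding A by auto
        qed
        show ?case
        proof
          fix y assume y: "y \<in> K n \<inter> generate (W n) (e n ` insert b A)"
          have "e n ` A \<subseteq> carrier (W n)" using A e_in by auto
          moreover have "y \<in> generate (W n) (insert (e n b) (e n ` A))" using y by simp
          ultimately obtain a :: int and w where w: "w \<in> L n b" "y = e n b [^]\<^bsub>W n\<^esub> a \<otimes>\<^bsub>W n\<^esub> w"
            unfolding L using e_in[OF b] by (elim generate_insertE)
          then have a: "a \<in> I n b" using y unfolding I_def by blast
          show "y \<in> ?P"
          proof (cases "a = 0")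
            case True
            then have "y = w" using w subsetD[OF L_carrier w(1)] by simp
            then show ?thesis using IH w y by blast
          next
            case False
            then obtain m u0 f where u0: "m \<le> D" "u0 \<in> E m" "f \<in> M m n" "act f u0 = b" "I m u0 = I n b"
              using D[OF b] a by blast
            then obtain w0 where w0: "w0 \<in> L m u0" "e m u0 [^]\<^bsub>W m\<^esub> a \<otimes>\<^bsub>W m\<^esub> w0 \<in> K m"
              using a unfolding I_def by blast
            \<comment> \<open>\<open>z\<close> comes from \<open>K m\<close> with
              \<open>m \<le> D\<close> and has the same leading term as \<open>y\<close>. The
              difference of the two lies in \<open>K n\<close> and in \<open>L n b\<close>, where
              the induction hypothesis applies.\<close>
            define z where "z = T m n f (e m u0 [^]\<^bsub>W m\<^esub> a \<otimes>\<^bsub>W m\<^esub> w0)"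
            define t where "t = T m n f w0"
            have z: "z = e n b [^]\<^bsub>W n\<^esub> a \<otimes>\<^bsub>W n\<^esub> t"
              unfolding z_def t_def using T_pow[OF u0(3,2) w0(1)] u0(4) by simp
            have t: "t \<in> L n b" unfolding t_def using T_L[OF u0(3,2) w0(1)] u0(4) by simp
            have zK: "z \<in> K n" unfolding z_def using T_K[OF u0(3)] w0(2) by blast
            have "z \<in> \<Union>{T m n f ` K m | m f. m \<le> D \<and> f \<in> M m n}"
              unfolding z_def using u0(1,3) w0(2) by blast
            then have zP: "z \<in> ?P" by (rule generate.incl)
            have c: "w \<in> carrier (W n)" "t \<in> carrier (W n)" "e n b [^]\<^bsub>W n\<^esub> a \<in> carrier (W n)"
              using w t L_carrier e_in[OF b] by auto
            have "y \<otimes>\<^bsub>W n\<^esub> inv\<^bsub>W n\<^esub> z = w \<otimes>\<^bsub>W n\<^esub> inv\<^bsub>W n\<^esub> t"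
              unfolding w(2) z by (rule mult_cancel_inv[OF c(3,1,2)])
            moreover have "y \<otimes>\<^bsub>W n\<^esub> inv\<^bsub>W n\<^esub> z \<in> K n"
              by (intro subgroup.m_closed[OF K_sub] subgroup.m_inv_closed[OF K_sub] IntD1[OF y] zK)
            moreover have "w \<otimes>\<^bsub>W n\<^esub> inv\<^bsub>W n\<^esub> t \<in> L n b"
              by (intro subgroup.m_closed[OF L_sub] subgroup.m_inv_closed[OF L_sub] w(1) t)
            ultimately have "y \<otimes>\<^bsub>W n\<^esub> inv\<^bsub>W n\<^esub> z \<in> ?P" using IH by auto
            then have "(y \<otimes>\<^bsub>W n\<^esub> inv\<^bsub>W n\<^esub> z) \<otimes>\<^bsub>W n\<^esub> z \<in> ?P"
              by (rule subgroup.m_closed[OF P_sub _ zP])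
            moreover have "y \<in> carrier (W n)" "z \<in> carrier (W n)"
              using y zK subgroup.subset[OF K_sub] by blast+
            ultimately show ?thesis by (simp add: m_assoc)
          qed
        qed
      qed
    qed
    from this[of "E n"] show ?thesis by blast
  qed
  then show ?thesis by blast
qed

section \<open>FI-modules over the integers are Noetherian\<close>

text \<open>The hypotheses say that there is room: \<open>le\<close> in front of the first
  prescribed value, \<open>gap\<close> between two of them, \<open>last_gap\<close> behind the last
  one. Subtraction of naturals truncates, so \<open>gap\<close> is vacuous unless
  \<open>w ! q < w ! p\<close>. If \<open>w\<close> is empty, \<open>mn\<close> alone provides the
  room.\<close>

lemma strict_mono_on_extend:
  fixes w w' :: "nat list"
  assumes len: "length w' = length w" and dist: "distinct w"
    and w': "set w' \<subseteq> {..<n}"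
    and mn: "m \<le> n"
    and le: "\<And>p. p < length w \<Longrightarrow> w ! p \<le> w' ! p"
    and gap: "\<And>p q. p < length w \<Longrightarrow> q < length w \<Longrightarrow> w ! p - w ! q \<le> w' ! p - w' ! q"
    and last_gap: "\<And>p. p < length w \<Longrightarrow> m - w ! p \<le> n - w' ! p"
  shows "\<exists>f. strict_mono_on {..<m} f \<and> f ` {..<m} \<subseteq> {..<n} \<and> map f w = w'"
proof -
  \<comment> \<open>The maximum of \<open>S x\<close> is the smallest possible choice for
    \<open>f x\<close>: a strictly increasing map satisfies \<open>x \<le> f x\<close>, and beyond a
    prescribed value it rises by at least 1 at each step.\<close>
  define S where "S x = insert x ((\<lambda>p. w' ! p + (x - w ! p)) ` {p. p < length w \<and> w ! p \<le> x})" for x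
  define f where "f x = Max (S x)" for x
  have fin: "finite (S x)" and ne: "S x \<noteq> {}" for x by (auto simp: S_def)
  have f_in: "f x \<in> S x" for x unfolding f_def by (rule Max_in[OF fin ne])
  have f_ge: "y \<le> f x" if "y \<in> S x" for x y unfolding f_def by (rule Max_ge[OF fin that])
  have "strict_mono_on {..<m} f"
  proof (rule strict_mono_onI)
    fix x y :: nat assume xy: "x < y"
    have "\<exists>z\<in>S y. f x < z"
      using f_in[of x] xy unfolding S_def by auto
    then show "f x < f y" using f_ge by (meson order_less_le_trans)
  qed
  moreover have "f x < n" if x: "x < m" for x
  proof -
    have "w' ! p + (x - w ! p) < n" if p: "p < length w" "w ! p \<le> x" for p
    proof -
      have "w' ! p \<in> set w'" using p len by simp
      then have "w' ! p < n" using w' by blast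
      then show ?thesis using last_gap[OF p(1)] p(2) x by linarith
    qed
    then show ?thesis using f_in[of x] x mn unfolding S_def by auto
  qed
  moreover have "f (w ! p) = w' ! p" if p: "p < length w" for p
  proof (rule antisym)
    have "w' ! q + (w ! p - w ! q) \<le> w' ! p" if q: "q < length w" "w ! q \<le> w ! p" for q
    proof (cases "p = q")
      case False
      then have "w ! q \<noteq> w ! p" using dist p q by (simp add: nth_eq_iff_index_eq)
      then show ?thesis using gap[OF p q(1)] q(2) by linarith
    qed simp
    then show "f (w ! p) \<le> w' ! p" using f_in[of "w ! p"] le[OF p] unfolding S_def by auto
    have "w' ! p + (w ! p - w ! p) \<in> S (w ! p)" using p unfolding S_def by blast
    then show "w' ! p \<le> f (w ! p)" using f_ge by fastforce
  qed
  ultimately show ?thesis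
    using len by (intro exI[of _ f]) (auto intro!: nth_equalityI)
qed

lemma map_less_map:
  fixes u v :: "nat list" and f :: "nat \<Rightarrow> nat"
  assumes "strict_mono_on A f" "set u \<subseteq> A" "set v \<subseteq> A" "u < v"
  shows "map f u < map f v"
  using assms(2-)
proof (induction u arbitrary: v)
  case Nil
  then show ?case by (cases v) auto
next
  case (Cons a u)
  then obtain b v' where v: "v = b # v'" by (cases v) auto
  then show ?case
    using Cons strict_mono_onD[OF assms(1), of a b] by auto
qed

section \<open>FI-modules and their submodules\<close>

text \<open>A functor from FI to abelian groups. An injection is encoded by a total function on the
  naturals, so the third clause has to say that its values outside \<open>I\<close> do not matter;
  it also allows a map to be replaced by any other with the same values on \<open>I\<close>.\<close>

definition fi_module ::
  "(nat set \<Rightarrow> 'b monoid) \<Rightarrow> (nat set \<Rightarrow> nat set \<Rightarrow> (nat \<Rightarrow> nat) \<Rightarrow> 'b \<Rightarrow> 'b) \<Rightarrow> bool" where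
  "fi_module W T \<longleftrightarrow>
     (\<forall>I. finite I \<longrightarrow> comm_group (W I)) \<and>
     (\<forall>I J f. FI_inj I J f \<longrightarrow> T I J f \<in> hom (W I) (W J)) \<and>
     (\<forall>I J f f' x. FI_inj I J f \<longrightarrow> (\<forall>i\<in>I. f i = f' i) \<longrightarrow> x \<in> carrier (W I) \<longrightarrow>
        T I J f x = T I J f' x) \<and>
     (\<forall>I x. finite I \<longrightarrow> x \<in> carrier (W I) \<longrightarrow> T I I id x = x) \<and>
     (\<forall>I J K f g x. FI_inj I J f \<longrightarrow> FI_inj J K g \<longrightarrow> x \<in> carrier (W I) \<longrightarrow>
        T I K (g \<circ> f) x = T J K g (T I J f x))"

lemma finite_set_iso_initial_segment:
  assumes "finite (J :: nat set)" "card J = n"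
  obtains f g where "FI_inj {..<n} J f" "FI_inj J {..<n} g" "f ` {..<n} = J" "\<And>x. x \<in> J \<Longrightarrow> f (g x) = x"
proof -
  obtain f where f: "bij_betw f {..<n} J"
    using assms ex_bij_betw_nat_finite[of J] by (auto simp: atLeast0LessThan)
  have g: "bij_betw (inv_into {..<n} f) J {..<n}" by (rule bij_betw_inv_into[OF f])
  show ?thesis
  proof (rule that[of f "inv_into {..<n} f"])
    show "FI_inj {..<n} J f" "FI_inj J {..<n} (inv_into {..<n} f)" "f ` {..<n} = J"
      using f g assms(1) by (auto simp: FI_inj_def bij_betw_def)
    show "f (inv_into {..<n} f x) = x" if "x \<in> J" for x
      using f that by (meson bij_betw_inv_into_right)
  qed
qed

lemma generate_mono_hom_image:
  assumes "group G" "group H" "h \<in> hom G H" "S \<subseteq> carrier G" "h ` S \<subseteq> generate H R" "R \<subseteq> carrier H"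
    and "x \<in> generate G S"
  shows "h x \<in> generate H R"
proof -
  interpret group_hom G H h using assms by (simp add: group_hom_def group_hom_axioms_def)
  have "h ` generate G S = generate H (h ` S)" by (rule generate_img[symmetric, OF assms(4)])
  also have "\<dots> \<subseteq> generate H R"
    by (rule H.generate_subgroup_incl[OF assms(5) H.generate_is_subgroup[OF assms(6)]])
  finally show ?thesis using assms(7) by blast
qed

text \<open>In degrees from \<open>B\<close> on, the module is spanned by the images of finitely
  many generators of \<open>W {..<B}\<close> under injections, and these images are the monomials.
  Restricting to the sets \<open>{..<n}\<close> makes the degrees a sequence; arbitrary finite sets
  are reached by transport along bijections, under which \<open>K\<close> is stable.\<close>

theorem fi_module_noetherian:
  assumes "fi_module W T"
    and gen: "\<And>J. finite J \<Longrightarrow>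
      carrier (W J) = generate (W J) (\<Union>{T I J id ` carrier (W I) | I. I \<subseteq> J \<and> card I \<le> B})"
    and fg: "\<And>I. finite I \<Longrightarrow> card I \<le> B \<Longrightarrow> finitely_generated_group (W I)"
    and K_sub: "\<And>J. finite J \<Longrightarrow> subgroup (K J) (W J)"
    and T_K: "\<And>I J f. FI_inj I J f \<Longrightarrow> T I J f ` K I \<subseteq> K J"
  shows "\<exists>D. \<forall>J. finite J \<longrightarrow>
    K J \<subseteq> generate (W J) (\<Union>{T I J id ` K I | I. I \<subseteq> J \<and> card I \<le> D})"
proof -
  note fim = assms(1)[unfolded fi_module_def]
  note W = conjunct1[OF fim, rule_format]
    and T_hom = conjunct1[OF conjunct2[OF fim], rule_format]
    and T_cong = conjunct1[OF conjunct2[OF conjunct2[OF fim]], rule_format]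
    and T_id = conjunct1[OF conjunct2[OF conjunct2[OF conjunct2[OF fim]]], rule_format]
    and T_comp = conjunct2[OF conjunct2[OF conjunct2[OF conjunct2[OF fim]]], rule_format, symmetric]
  have Wg: "\<And>I. finite I \<Longrightarrow> group (W I)" using W by (simp add: comm_group.axioms)
  have T_in: "\<And>I J f x. FI_inj I J f \<Longrightarrow> x \<in> carrier (W I) \<Longrightarrow> T I J f x \<in> carrier (W J)"
    using hom_in_carrier[OF T_hom] by blast
  have KW: "\<And>J. finite J \<Longrightarrow> K J \<subseteq> carrier (W J)" using K_sub by (simp add: subgroup.subset)
  obtain S where S: "finite S" "S \<subseteq> carrier (W {..<B})" "generate (W {..<B}) S = carrier (W {..<B})"
    using fg[of "{..<B}"] unfolding finitely_generated_group_def by auto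
  obtain \<xi> where \<xi>: "set \<xi> = S" using finite_list[OF S(1)] by blast
  define r where "r = length \<xi>"
  define M where "M m n = {f::nat\<Rightarrow>nat. strict_mono_on {..<m} f \<and> f ` {..<m} \<subseteq> {..<n}}" for m n
  \<comment> \<open>The monomial s # w stands for the image of the s-th generator under the injection i \<mapsto> w ! i.
    Only order-preserving injections act on monomials, so that the lexicographic order is preserved.\<close>
  define E where "E n = {s # w | s w. s < r \<and> length w = B \<and> distinct w \<and> set w \<subseteq> {..<n}}" for n
  define act where "act f u = hd u # map f (tl u)" for f :: "nat \<Rightarrow> nat" and u :: "nat list"
  define e where "e n u = T {..<B} {..<n} (\<lambda>i. tl u ! i) (\<xi> ! hd u)" for n u
  have M_inj: "FI_inj {..<m} {..<n} f" if "f \<in> M m n" for m n f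
    using that by (auto simp: M_def FI_inj_def dest: strict_mono_on_imp_inj_on)
  have E_inj: "FI_inj {..<B} {..<n} (\<lambda>i. tl u ! i)" and E_\<xi>: "\<xi> ! hd u \<in> carrier (W {..<B})"
    if "u \<in> E n" for n u
  proof -
    from that obtain s w where u: "u = s # w" "s < r" "length w = B" "distinct w" "set w \<subseteq> {..<n}"
      by (auto simp: E_def)
    have "w ! i < n" if "i < B" for i
      using that u(3) subsetD[OF u(5) nth_mem[of i w]] by simp
    then show "FI_inj {..<B} {..<n} (\<lambda>i. tl u ! i)"
      using u by (auto simp: FI_inj_def intro!: inj_on_nth)
    have "\<xi> ! s \<in> set \<xi>" using u by (simp add: r_def)
    then show "\<xi> ! hd u \<in> carrier (W {..<B})" using u \<xi> S by auto
  qed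
  have e_in: "e n u \<in> carrier (W {..<n})" if "u \<in> E n" for n u
    unfolding e_def by (rule T_in[OF E_inj[OF that] E_\<xi>[OF that]])
  have "\<exists>D. \<forall>n. K {..<n} \<inter> generate (W {..<n}) (e n ` E n)
    \<subseteq> generate (W {..<n}) (\<Union>{T {..<m} {..<n} f ` K {..<m} | m f. m \<le> D \<and> f \<in> M m n})"
  proof (rule bounded_generation_of_wqo[where act = act])
    show "comm_group (W {..<n})" for n by (simp add: W)
    show "finite (E n)" for n
    proof (rule finite_subset)
      show "E n \<subseteq> {u. set u \<subseteq> {..<max r n} \<and> length u = Suc B}"
        by (auto simp: E_def less_max_iff_disj)
      show "finite {u. set u \<subseteq> {..<max r n} \<and> length u = Suc B}"
        by (rule finite_lists_length_eq) simp
    qed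
    show "e n u \<in> carrier (W {..<n})" if "u \<in> E n" for n u by (rule e_in[OF that])
    show "T {..<m} {..<n} f \<in> hom (W {..<m}) (W {..<n})" if "f \<in> M m n" for m n f
      by (rule T_hom[OF M_inj[OF that]])
    show "act f u \<in> E n" if "f \<in> M m n" "u \<in> E m" for m n f u
    proof -
      from that obtain s w where u: "u = s # w" "s < r" "length w = B" "distinct w" "set w \<subseteq> {..<m}"
        by (auto simp: E_def)
      have "inj_on f (set w)"
        using M_inj[OF that(1)] u(5) by (auto simp: FI_inj_def intro: inj_on_subset)
      then show ?thesis using u that(1) by (auto simp: act_def E_def M_def distinct_map)
    qed
    show "act f u < act f v" if f: "f \<in> M m n" and uv_E: "u \<in> E m" "v \<in> E m" and less: "u < v" for m n f u v
    proof -
      obtain s w s' w' where uv: "u = s # w" "v = s' # w'" "set w \<subseteq> {..<m}" "set w' \<subseteq> {..<m}"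
        using uv_E unfolding E_def by blast
      have "w < w' \<Longrightarrow> map f w < map f w'"
        using map_less_map[of "{..<m}" f w w'] uv f by (simp add: M_def)
      then show ?thesis using less uv by (auto simp: act_def)
    qed
    show "T {..<m} {..<n} f (e m u) = e n (act f u)" if f: "f \<in> M m n" and u: "u \<in> E m" for m n f u
    proof -
      have len: "length (tl u) = B" using u by (auto simp: E_def)
      have "T {..<m} {..<n} f (e m u) = T {..<B} {..<n} (f \<circ> (\<lambda>i. tl u ! i)) (\<xi> ! hd u)"
        unfolding e_def by (rule T_comp[OF E_inj[OF u] M_inj[OF f] E_\<xi>[OF u]])
      also have "\<dots> = e n (act f u)"
        unfolding e_def act_def list.sel
      proof (rule T_cong[OF _ _ E_\<xi>[OF u]])
        show "FI_inj {..<B} {..<n} (f \<circ> (\<lambda>i. tl u ! i))"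
          using E_inj[OF u] M_inj[OF f] unfolding FI_inj_def
          by (auto intro!: comp_inj_on intro: inj_on_subset)
      qed (use len in simp)
      finally show ?thesis .
    qed
    show "subgroup (K {..<n}) (W {..<n})" for n by (simp add: K_sub)
    show "T {..<m} {..<n} f ` K {..<m} \<subseteq> K {..<n}" if "f \<in> M m n" for m n f
      by (rule T_K[OF M_inj[OF that]])
    fix l :: "nat \<Rightarrow> nat" and u :: "nat \<Rightarrow> nat list" and d :: "nat \<Rightarrow> nat"
    assume u: "\<And>i. u i \<in> E (l i)"
    \<comment> \<open>Listing both \<open>hd\<close> and \<open>r - hd\<close> forces the index of
      the generator to be constant, as it is less than \<open>r\<close>. The remaining families are
      the positions, the gaps between two of them and the distances to the right end, as
      \<open>strict_mono_on_extend\<close> requires.\<close>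
    define C where "C = {d, l, \<lambda>i. hd (u i), \<lambda>i. r - hd (u i)}
      \<union> (\<lambda>p i. tl (u i) ! p) ` {..<B}
      \<union> (\<lambda>(p, q) i. tl (u i) ! p - tl (u i) ! q) ` ({..<B} \<times> {..<B})
      \<union> (\<lambda>p i. l i - tl (u i) ! p) ` {..<B}"
    have "finite C" by (simp add: C_def)
    then obtain \<sigma> where \<sigma>: "strict_mono \<sigma>" "\<forall>c\<in>C. incseq (\<lambda>n. c (\<sigma> n))"
      using dickson_subseq[of C] by blast
    have C_le: "c (\<sigma> i) \<le> c (\<sigma> j)" if "c \<in> C" "i < j" for c i j
      using \<sigma>(2) that unfolding incseq_def by (meson less_imp_le)
    have "d (\<sigma> i) \<le> d (\<sigma> j) \<and> (\<exists>f \<in> M (l (\<sigma> i)) (l (\<sigma> j)). act f (u (\<sigma> i)) = u (\<sigma> j))"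
      if ij: "i < j" for i j
    proof -
      obtain s w where w: "u (\<sigma> i) = s # w" "s < r" "length w = B" "distinct w" "set w \<subseteq> {..<l (\<sigma> i)}"
        using u[of "\<sigma> i"] by (auto simp: E_def)
      obtain s' w' where w': "u (\<sigma> j) = s' # w'" "s' < r" "length w' = B" "set w' \<subseteq> {..<l (\<sigma> j)}"
        using u[of "\<sigma> j"] by (auto simp: E_def)
      have d: "d (\<sigma> i) \<le> d (\<sigma> j)" and l: "l (\<sigma> i) \<le> l (\<sigma> j)"
        using C_le[of d, OF _ ij] C_le[of l, OF _ ij] by (auto simp: C_def)
      have "hd (u (\<sigma> i)) \<le> hd (u (\<sigma> j))" "r - hd (u (\<sigma> i)) \<le> r - hd (u (\<sigma> j))"
        using C_le[of "\<lambda>i. hd (u i)", OF _ ij] C_le[of "\<lambda>i. r - hd (u i)", OF _ ij] by (auto simp: C_def)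
      then have s: "s = s'" using w w' by simp
      have "w ! p \<le> w' ! p" if "p < B" for p
        using C_le[of "\<lambda>i. tl (u i) ! p", OF _ ij] that w w' by (simp add: C_def)
      moreover have "w ! p - w ! q \<le> w' ! p - w' ! q" if "p < B" "q < B" for p q
      proof -
        have "(\<lambda>i. tl (u i) ! p - tl (u i) ! q) \<in> C"
          unfolding C_def using that by (intro UnI1[OF UnI2] image_eqI[of _ _ "(p, q)"]) auto
        from C_le[OF this ij] show ?thesis using w w' by simp
      qed
      moreover have "l (\<sigma> i) - w ! p \<le> l (\<sigma> j) - w' ! p" if "p < B" for p
        using C_le[of "\<lambda>i. l i - tl (u i) ! p", OF _ ij] that w w' by (simp add: C_def)
      ultimately have "\<exists>f. strict_mono_on {..<l (\<sigma> i)} f \<and> f ` {..<l (\<sigma> i)} \<subseteq> {..<l (\<sigma> j)} \<and> map f w = w'"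
        using w w' l by (intro strict_mono_on_extend) auto
      then show ?thesis using d s w w' by (auto simp: M_def act_def)
    qed
    with \<sigma>(1) show "\<exists>\<sigma> :: nat \<Rightarrow> nat. strict_mono \<sigma> \<and> (\<forall>i j. i < j \<longrightarrow> d (\<sigma> i) \<le> d (\<sigma> j) \<and>
        (\<exists>f \<in> M (l (\<sigma> i)) (l (\<sigma> j)). act f (u (\<sigma> i)) = u (\<sigma> j)))" by blast
  qed
  then obtain D where D: "\<And>n. K {..<n} \<inter> generate (W {..<n}) (e n ` E n)
    \<subseteq> generate (W {..<n}) (\<Union>{T {..<m} {..<n} f ` K {..<m} | m f. m \<le> D \<and> f \<in> M m n})" by blast
  have e_gen: "carrier (W {..<n}) \<subseteq> generate (W {..<n}) (e n ` E n)" if n: "B \<le> n" for n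
  proof -
    interpret group "W {..<n}" by (simp add: Wg)
    have E_sub: "subgroup (generate (W {..<n}) (e n ` E n)) (W {..<n})"
      by (rule generate_is_subgroup) (use e_in in auto)
    have "T I {..<n} id y \<in> generate (W {..<n}) (e n ` E n)"
      if I: "I \<subseteq> {..<n}" "card I \<le> B" and y: "y \<in> carrier (W I)" for I y
    proof -
      \<comment> \<open>\<open>I\<close> is enlarged to exactly \<open>B\<close> elements, which is
        possible since \<open>B \<le> n\<close>. The element \<open>y\<close> can then be moved to
        the single group \<open>W {..<B}\<close> by \<open>g\<close> and back by \<open>f\<close>,
        because \<open>f \<circ> g\<close> is the identity on \<open>I'\<close>.\<close>
      obtain I' where I': "I \<subseteq> I'" "I' \<subseteq> {..<n}" "card I' = B"
        using exists_subset_between[of I B "{..<n}"] I n by auto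
      then have finI: "finite I'" "finite I" using finite_subset I(1) by (blast intro: finite_subset[OF _ finite_lessThan])+
      obtain f g where fg: "FI_inj {..<B} I' f" "FI_inj I' {..<B} g" "f ` {..<B} = I'" "\<And>x. x \<in> I' \<Longrightarrow> f (g x) = x"
        using finite_set_iso_initial_segment[OF finI(1) I'(3)] by blast
      have f: "FI_inj {..<B} {..<n} f" using fg(1) I' by (auto simp: FI_inj_def)
      have g: "FI_inj I {..<B} g" using fg(2) I' finI by (auto simp: FI_inj_def intro: inj_on_subset)
      define z where "z = T I {..<B} g y"
      have z: "z \<in> generate (W {..<B}) S" unfolding z_def S(3) by (rule T_in[OF g y])
      have "T I {..<n} id y = T I {..<n} (f \<circ> g) y"
        using I I' finI fg(4) by (intro T_cong[OF _ _ y]) (auto simp: FI_inj_def)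
      also have "\<dots> = T {..<B} {..<n} f z" unfolding z_def by (rule T_comp[OF g f y, symmetric])
      also have "\<dots> \<in> generate (W {..<n}) (e n ` E n)"
      proof (rule generate_mono_hom_image[OF _ _ T_hom[OF f] S(2) _ _ z])
        show "T {..<B} {..<n} f ` S \<subseteq> generate (W {..<n}) (e n ` E n)"
        proof
          fix t assume "t \<in> T {..<B} {..<n} f ` S"
          then obtain s where s: "s < r" "t = T {..<B} {..<n} f (\<xi> ! s)"
            unfolding \<xi>[symmetric] r_def by (auto simp: in_set_conv_nth)
          have \<xi>s: "\<xi> ! s \<in> carrier (W {..<B})" using s S(2) \<xi> by (auto simp: r_def)
          have "t = e n (s # map f [0..<B])"
            unfolding e_def s(2) list.sel by (rule T_cong[OF f _ \<xi>s]) simp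
          moreover have "s # map f [0..<B] \<in> E n"
            using f s(1) by (auto simp: E_def FI_inj_def distinct_map atLeast0LessThan)
          ultimately show "t \<in> generate (W {..<n}) (e n ` E n)" by (blast intro: generate.incl)
        qed
      qed (use e_in Wg in auto)
      finally show ?thesis .
    qed
    then have "\<Union>{T I {..<n} id ` carrier (W I) | I. I \<subseteq> {..<n} \<and> card I \<le> B} \<subseteq> generate (W {..<n}) (e n ` E n)"
      by blast
    from generate_subgroup_incl[OF this E_sub] show ?thesis using gen[of "{..<n}"] by simp
  qed
  \<comment> \<open>A set \<open>J\<close> of at most \<open>max D B\<close> elements is itself an
    admissible \<open>I\<close>. A larger one has more than \<open>B\<close> elements, so the
    monomials span there.\<close>
  have "K J \<subseteq> generate (W J) (\<Union>{T I J id ` K I | I. I \<subseteq> J \<and> card I \<le> max D B})" (is "_ \<subseteq> generate _ ?R")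
    if J: "finite J" for J
  proof
    fix x assume x: "x \<in> K J"
    then have xW: "x \<in> carrier (W J)" using KW[OF J] by blast
    show "x \<in> generate (W J) ?R"
    proof (cases "card J \<le> max D B")
      case True
      have "x = T J J id x" using T_id[OF J xW] by simp
      then have "x \<in> ?R" using True x by blast
      then show ?thesis by (rule generate.incl)
    next
      case False
      define n where "n = card J"
      obtain f g where fg: "FI_inj {..<n} J f" "FI_inj J {..<n} g" "f ` {..<n} = J" "\<And>x. x \<in> J \<Longrightarrow> f (g x) = x"
        using finite_set_iso_initial_segment[OF J n_def[symmetric]] by blast
      have "T J {..<n} g x \<in> K {..<n}" using T_K[OF fg(2)] x by blast
      moreover have "T J {..<n} g x \<in> generate (W {..<n}) (e n ` E n)"
        using subsetD[OF e_gen[of n] T_in[OF fg(2) xW]] False by (simp add: n_def)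
      ultimately have gx: "T J {..<n} g x
          \<in> generate (W {..<n}) (\<Union>{T {..<m} {..<n} f ` K {..<m} | m f. m \<le> D \<and> f \<in> M m n})"
        using D[of n] by blast
      have "T {..<n} J f (T J {..<n} g x) \<in> generate (W J) ?R"
      proof (rule generate_mono_hom_image[OF _ _ T_hom[OF fg(1)] _ _ _ gx])
        show "group (W {..<n})" "group (W J)" using Wg J by auto
        show "\<Union>{T {..<m} {..<n} f ` K {..<m} | m f. m \<le> D \<and> f \<in> M m n} \<subseteq> carrier (W {..<n})"
          using T_K[OF M_inj] KW[of "{..<n}"] by blast
        have "FI_inj I J id" if "I \<subseteq> J" for I
          using that J by (auto simp: FI_inj_def intro: finite_subset)
        then show "?R \<subseteq> carrier (W J)" using T_K KW[OF J] by blast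
        have "T {..<n} J f (T {..<m} {..<n} h y) \<in> ?R" if m: "m \<le> D" "h \<in> M m n" "y \<in> K {..<m}" for m h y
        proof -
          \<comment> \<open>The injection \<open>f \<circ> h\<close> factors as a bijection onto its
            image \<open>I\<close> followed by the inclusion of \<open>I\<close>. The bijection
            preserves \<open>K\<close>, so only inclusions remain in the conclusion.\<close>
          define I where "I = (f \<circ> h) ` {..<m}"
          have y: "y \<in> carrier (W {..<m})" using KW[of "{..<m}"] m(3) by auto
          have fh: "inj_on (f \<circ> h) {..<m}"
            using fg(1) M_inj[OF m(2)] unfolding FI_inj_def by (auto intro!: comp_inj_on intro: inj_on_subset)
          have IJ: "I \<subseteq> J" using fg(1) M_inj[OF m(2)] unfolding FI_inj_def I_def by auto
          have h: "FI_inj {..<m} I (f \<circ> h)" using fh by (auto simp: FI_inj_def I_def)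
          have i: "FI_inj I J id" using IJ J by (auto simp: FI_inj_def intro: finite_subset)
          have "T {..<n} J f (T {..<m} {..<n} h y) = T {..<m} J (f \<circ> h) y"
            by (rule T_comp[OF M_inj[OF m(2)] fg(1) y])
          also have "\<dots> = T I J id (T {..<m} I (f \<circ> h) y)"
            using T_comp[OF h i y] by simp
          also have "\<dots> \<in> ?R"
          proof -
            have "T {..<m} I (f \<circ> h) y \<in> K I" using T_K[OF h] m(3) by blast
            moreover have "card I \<le> max D B" using m(1) card_image[OF fh] by (simp add: I_def)
            ultimately show ?thesis using IJ by blast
          qed
          finally show ?thesis .
        qed
        then show "T {..<n} J f ` \<Union>{T {..<m} {..<n} f ` K {..<m} | m f. m \<le> D \<and> f \<in> M m n}
            \<subseteq> generate (W J) ?R"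
          by (auto intro!: generate.incl)
      qed
      also have "T {..<n} J f (T J {..<n} g x) = T J J (f \<circ> g) x" by (rule T_comp[OF fg(2,1) xW])
      also have "\<dots> = T J J id x"
        using T_cong[of J J id "f \<circ> g", OF _ _ xW] fg(4) J by (simp add: FI_inj_def)
      finally show ?thesis unfolding T_id[OF J xW] .
    qed
  qed
  then show ?thesis by blast
qed

section \<open>Weak FI-groups\<close>

text \<open>A pointwise form of \<open>conj_equiv\<close>, in which the conjugating element may vary
  with the element. This is enough because normal subgroups, and later the quotient by
  \<open>N\<close>, do not distinguish conjugates.\<close>

definition conjugate :: "('a, 'b) monoid_scheme \<Rightarrow> 'a \<Rightarrow> 'a \<Rightarrow> bool" where
  "conjugate B x y \<longleftrightarrow> y \<in> carrier B \<and> (\<exists>b \<in> carrier B. x = b \<otimes>\<^bsub>B\<^esub> y \<otimes>\<^bsub>B\<^esub> inv\<^bsub>B\<^esub> b)"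

lemma (in group) conjugate_sym:
  assumes "conjugate G x y"
  shows "conjugate G y x"
proof -
  obtain b where b: "b \<in> carrier G" "y \<in> carrier G" "x = b \<otimes> y \<otimes> inv b"
    using assms by (auto simp: conjugate_def)
  then have "inv b \<otimes> x \<otimes> b = (inv b \<otimes> b) \<otimes> y \<otimes> (inv b \<otimes> b)"
    by (simp only: m_assoc inv_closed m_closed)
  then have "y = inv b \<otimes> x \<otimes> inv (inv b)" using b by simp
  moreover have "inv b \<in> carrier G" "x \<in> carrier G" using b by simp_all
  ultimately show ?thesis unfolding conjugate_def by blast
qed

lemma (in group) conjugate_trans:
  assumes "conjugate G x y" "conjugate G y z"
  shows "conjugate G x z"
proof -
  obtain b c where b: "b \<in> carrier G" "x = b \<otimes> y \<otimes> inv b" and c: "c \<in> carrier G" "z \<in> carrier G" "y = c \<otimes> z \<otimes> inv c"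
    using assms by (auto simp: conjugate_def)
  then have "x = (b \<otimes> c) \<otimes> z \<otimes> inv (b \<otimes> c)"
    by (simp add: inv_mult_group m_assoc)
  then show ?thesis using b(1) c(1,2) unfolding conjugate_def by blast
qed

lemma (in group_hom) conjugate_image:
  assumes "conjugate G x y"
  shows "conjugate H (h x) (h y)"
  using assms by (auto simp: conjugate_def)

lemma (in group) conjugate_mem_normal:
  assumes "N \<lhd> G" "conjugate G x y"
  shows "x \<in> N \<longleftrightarrow> y \<in> N"
proof -
  have "x \<in> N" if "conjugate G x y" "y \<in> N" for x y
    using that normal.inv_op_closed2[OF assms(1)] by (auto simp: conjugate_def)
  then show ?thesis using assms(2) conjugate_sym by blast
qed

lemma conj_equivD:
  assumes "conj_equiv A B phi psi" "psi \<in> hom A B" "x \<in> carrier A"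
  shows "conjugate B (phi x) (psi x)"
  using assms hom_in_carrier[OF assms(2,3)] by (auto simp: conj_equiv_def conjugate_def)

lemma (in group) rcos_eq_iff:
  assumes "subgroup N G" "x \<in> carrier G" "y \<in> carrier G"
  shows "N #> x = N #> y \<longleftrightarrow> x \<otimes> inv y \<in> N"
  using subgroup.rcos_module[OF assms(1) is_group assms(3,2)]
    repr_independence[of x N y, OF _ assms(3,1)] rcos_self[OF assms(2,1)] by auto

text \<open>The preimage of the centralizer of \<open>y\<close> is a subgroup, so commutation need
  only be checked on generators. With \<open>h\<close> a quotient map this gives commutation modulo
  a normal subgroup.\<close>

lemma (in group_hom) commute_generate:
  assumes "S \<subseteq> carrier G" "y \<in> carrier H" "\<And>s. s \<in> S \<Longrightarrow> h s \<otimes>\<^bsub>H\<^esub> y = y \<otimes>\<^bsub>H\<^esub> h s" "x \<in> generate G S"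
  shows "h x \<otimes>\<^bsub>H\<^esub> y = y \<otimes>\<^bsub>H\<^esub> h x"
proof -
  have comm_inv: "inv\<^bsub>H\<^esub> s \<otimes>\<^bsub>H\<^esub> y = y \<otimes>\<^bsub>H\<^esub> inv\<^bsub>H\<^esub> s" if "s \<in> carrier H" "s \<otimes>\<^bsub>H\<^esub> y = y \<otimes>\<^bsub>H\<^esub> s" for s
  proof -
    have "s \<otimes>\<^bsub>H\<^esub> (y \<otimes>\<^bsub>H\<^esub> inv\<^bsub>H\<^esub> s) = y"
      using that assms(2) by (simp add: H.m_assoc[symmetric]) (simp add: H.m_assoc)
    then show ?thesis using that(1) assms(2) by (metis H.inv_closed H.inv_solve_left H.m_closed)
  qed
  from assms(4) show ?thesis
  proof (induction rule: generate.induct)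
    case one
    then show ?case using assms(2) by simp
  next
    case (incl x)
    then show ?case by (rule assms(3))
  next
    case (inv x)
    then have "x \<in> carrier G" using assms(1) by blast
    then show ?case using comm_inv[OF _ assms(3)[OF inv]] by simp
  next
    case (eng x1 x2)
    have c: "h x1 \<in> carrier H" "h x2 \<in> carrier H"
      using eng(1,2) G.generate_in_carrier[OF assms(1)] by simp_all
    have "h x1 \<otimes>\<^bsub>H\<^esub> h x2 \<otimes>\<^bsub>H\<^esub> y = h x1 \<otimes>\<^bsub>H\<^esub> y \<otimes>\<^bsub>H\<^esub> h x2"
      using c assms(2) eng(4) by (simp add: H.m_assoc)
    also have "\<dots> = y \<otimes>\<^bsub>H\<^esub> (h x1 \<otimes>\<^bsub>H\<^esub> h x2)"
      using c assms(2) eng(3) by (simp add: H.m_assoc)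
    finally show ?case using eng(1,2) G.generate_in_carrier[OF assms(1)] by simp
  qed
qed

section \<open>Bounded normal closures in a weak FI-group\<close>

text \<open>The right-hand side of bounded normal generation, kept as a function of \<open>J\<close>
  so that it can itself be shown to be a normal weak FI-subgroup.\<close>

definition bounded_normal_closure ::
  "(nat set \<Rightarrow> 'a monoid) \<Rightarrow> (nat set \<Rightarrow> nat set \<Rightarrow> 'a \<Rightarrow> 'a) \<Rightarrow> (nat set \<Rightarrow> 'a set) \<Rightarrow> nat \<Rightarrow> nat set \<Rightarrow> 'a set" where
  "bounded_normal_closure G Ginc H D J = generate (G J)
     {g \<otimes>\<^bsub>G J\<^esub> h \<otimes>\<^bsub>G J\<^esub> inv\<^bsub>G J\<^esub> g | g h I.
        g \<in> carrier (G J) \<and> I \<subseteq> J \<and> card I \<le> D \<and> h \<in> sub_at Ginc H J I}"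

locale weak_FI =
  fixes G :: "nat set \<Rightarrow> 'a monoid"
    and Gf :: "nat set \<Rightarrow> nat set \<Rightarrow> (nat \<Rightarrow> nat) \<Rightarrow> 'a \<Rightarrow> 'a"
    and Ginc :: "nat set \<Rightarrow> nat set \<Rightarrow> 'a \<Rightarrow> 'a"
  assumes weak: "weak_FI_group G Gf Ginc"
begin

lemma grp: "finite I \<Longrightarrow> group (G I)"
  and Gf_hom: "FI_inj I J f \<Longrightarrow> Gf I J f \<in> hom (G I) (G J)"
  and Ginc_hom: "finite J \<Longrightarrow> I \<subseteq> J \<Longrightarrow> Ginc I J \<in> hom (G I) (G J)"
  and Ginc_Ginc: "finite K \<Longrightarrow> I \<subseteq> J \<Longrightarrow> J \<subseteq> K \<Longrightarrow> x \<in> carrier (G I) \<Longrightarrow> Ginc J K (Ginc I J x) = Ginc I K x"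
  using weak unfolding weak_FI_group_def by simp_all

lemma Gf_carrier: "FI_inj I J f \<Longrightarrow> x \<in> carrier (G I) \<Longrightarrow> Gf I J f x \<in> carrier (G J)"
  by (rule hom_in_carrier[OF Gf_hom])

lemma Ginc_carrier: "finite J \<Longrightarrow> I \<subseteq> J \<Longrightarrow> x \<in> carrier (G I) \<Longrightarrow> Ginc I J x \<in> carrier (G J)"
  by (rule hom_in_carrier[OF Ginc_hom])

lemma FI_inj_incl: "finite J \<Longrightarrow> I \<subseteq> J \<Longrightarrow> FI_inj I J id"
  by (auto simp: FI_inj_def intro: finite_subset)

lemma FI_inj_comp: "FI_inj I J f \<Longrightarrow> FI_inj J K g \<Longrightarrow> FI_inj I K (g \<circ> f)"
  unfolding FI_inj_def by (auto intro!: comp_inj_on intro: inj_on_subset)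

lemma Gf_group_hom: "FI_inj I J f \<Longrightarrow> group_hom (G I) (G J) (Gf I J f)"
  using grp Gf_hom by (simp add: group_hom_def group_hom_axioms_def FI_inj_def)

lemma Ginc_group_hom: "finite J \<Longrightarrow> I \<subseteq> J \<Longrightarrow> group_hom (G I) (G J) (Ginc I J)"
  using grp Ginc_hom by (simp add: group_hom_def group_hom_axioms_def finite_subset)

lemma Gf_cong:
  assumes "FI_inj I J f" "\<forall>i\<in>I. f i = f' i" "x \<in> carrier (G I)"
  shows "conjugate (G J) (Gf I J f x) (Gf I J f' x)"
proof -
  have f': "FI_inj I J f'"
    using assms(1,2) by (auto simp: FI_inj_def cong: inj_on_cong image_cong)
  have "conj_equiv (G I) (G J) (Gf I J f) (Gf I J f')"
    using weak assms(1,2) f' unfolding weak_FI_group_def by simp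
  from conj_equivD[OF this Gf_hom[OF f'] assms(3)] show ?thesis .
qed

lemma Gf_id:
  assumes "finite I" "x \<in> carrier (G I)"
  shows "conjugate (G I) (Gf I I id x) x"
proof -
  have "conj_equiv (G I) (G I) (Gf I I id) id"
    using weak assms(1) unfolding weak_FI_group_def by simp
  from conj_equivD[OF this _ assms(2)] show ?thesis by (simp add: hom_def)
qed

lemma Gf_comp:
  assumes "FI_inj I J f" "FI_inj J K g" "x \<in> carrier (G I)"
  shows "conjugate (G K) (Gf I K (g \<circ> f) x) (Gf J K g (Gf I J f x))"
proof -
  have e: "conj_equiv (G I) (G K) (Gf I K (g \<circ> f)) (Gf J K g \<circ> Gf I J f)"
    using weak assms unfolding weak_FI_group_def by simp
  have "Gf J K g \<circ> Gf I J f \<in> hom (G I) (G K)"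
    by (rule hom_compose[OF Gf_hom[OF assms(1)] Gf_hom[OF assms(2)]])
  from conj_equivD[OF e this assms(3)] show ?thesis by simp
qed

lemma Ginc_Gf:
  assumes "finite J" "I \<subseteq> J" "x \<in> carrier (G I)"
  shows "conjugate (G J) (Ginc I J x) (Gf I J id x)"
proof -
  have "conj_equiv (G I) (G J) (Ginc I J) (Gf I J id)"
    using weak assms unfolding weak_FI_group_def by simp
  from conj_equivD[OF this Gf_hom[OF FI_inj_incl[OF assms(1,2)]] assms(3)] show ?thesis .
qed

end

locale weak_FI_normal = weak_FI +
  fixes H
  assumes normal_H: "normal_weak_FI_subgroup H G Gf"
begin

lemma H_normal: "finite I \<Longrightarrow> H I \<lhd> G I"
  and Gf_H: "FI_inj I J f \<Longrightarrow> x \<in> H I \<Longrightarrow> Gf I J f x \<in> H J"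
  using normal_H unfolding normal_weak_FI_subgroup_def by (simp, meson image_subset_iff)

lemma H_subgroup: "finite I \<Longrightarrow> subgroup (H I) (G I)"
  using H_normal normal_imp_subgroup by blast

lemma H_carrier: "finite I \<Longrightarrow> x \<in> H I \<Longrightarrow> x \<in> carrier (G I)"
  using subgroup.subset[OF H_subgroup] by blast

lemma Ginc_H:
  assumes "finite J" "I \<subseteq> J" "x \<in> H I"
  shows "Ginc I J x \<in> H J"
proof -
  have x: "x \<in> carrier (G I)" using assms H_carrier finite_subset by blast
  show ?thesis
    using group.conjugate_mem_normal[OF grp H_normal Ginc_Gf[OF assms(1,2) x]]
      Gf_H[OF FI_inj_incl[OF assms(1,2)] assms(3)] assms(1) by simp
qed

abbreviation closure_gens :: "nat \<Rightarrow> nat set \<Rightarrow> 'a set" where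
  "closure_gens D J \<equiv> {g \<otimes>\<^bsub>G J\<^esub> h \<otimes>\<^bsub>G J\<^esub> inv\<^bsub>G J\<^esub> g | g h I.
        g \<in> carrier (G J) \<and> I \<subseteq> J \<and> card I \<le> D \<and> h \<in> sub_at Ginc H J I}"

abbreviation N :: "nat \<Rightarrow> nat set \<Rightarrow> 'a set" where
  "N \<equiv> bounded_normal_closure G Ginc H"

lemma closure_gensE:
  assumes "x \<in> closure_gens D J"
  obtains I y where "I \<subseteq> J" "card I \<le> D" "y \<in> H I"
    "\<exists>g\<in>carrier (G J). x = g \<otimes>\<^bsub>G J\<^esub> Ginc I J y \<otimes>\<^bsub>G J\<^esub> inv\<^bsub>G J\<^esub> g"
  using assms unfolding sub_at_def by blast

lemma closure_gens_H:
  assumes "finite J"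
  shows "closure_gens D J \<subseteq> H J"
proof
  fix x assume "x \<in> closure_gens D J"
  then obtain I y where y: "I \<subseteq> J" "card I \<le> D" "y \<in> H I"
    "\<exists>g\<in>carrier (G J). x = g \<otimes>\<^bsub>G J\<^esub> Ginc I J y \<otimes>\<^bsub>G J\<^esub> inv\<^bsub>G J\<^esub> g" by (rule closure_gensE)
  then show "x \<in> H J"
    using normal.inv_op_closed2[OF H_normal[OF assms] _ Ginc_H[OF assms y(1,3)]] by auto
qed

lemma N_le_H:
  assumes "finite J"
  shows "N D J \<subseteq> H J"
  unfolding bounded_normal_closure_def
  by (rule group.generate_subgroup_incl[OF grp[OF assms] closure_gens_H[OF assms] H_subgroup[OF assms]])

lemma N_normal:
  assumes "finite J"
  shows "N D J \<lhd> G J"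
  unfolding bounded_normal_closure_def
proof (rule group.normal_generateI[OF grp[OF assms]])
  interpret group "G J" by (rule grp[OF assms])
  show "closure_gens D J \<subseteq> carrier (G J)"
    using closure_gens_H[OF assms] H_carrier[OF assms] by blast
  fix x g assume x: "x \<in> closure_gens D J" and g: "g \<in> carrier (G J)"
  from x obtain k h I where h: "x = k \<otimes>\<^bsub>G J\<^esub> h \<otimes>\<^bsub>G J\<^esub> inv\<^bsub>G J\<^esub> k" "k \<in> carrier (G J)" "I \<subseteq> J" "card I \<le> D" "h \<in> sub_at Ginc H J I"
    by blast
  have "h \<in> carrier (G J)" using h(3,5) Ginc_H[OF assms h(3)] H_carrier[OF assms] by (auto simp: sub_at_def)
  then have "g \<otimes>\<^bsub>G J\<^esub> x \<otimes>\<^bsub>G J\<^esub> inv\<^bsub>G J\<^esub> g = (g \<otimes>\<^bsub>G J\<^esub> k) \<otimes>\<^bsub>G J\<^esub> h \<otimes>\<^bsub>G J\<^esub> inv\<^bsub>G J\<^esub> (g \<otimes>\<^bsub>G J\<^esub> k)"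
    using g h(1,2) by (simp add: inv_mult_group m_assoc)
  moreover have "g \<otimes>\<^bsub>G J\<^esub> k \<in> carrier (G J)" using g h by simp
  ultimately show "g \<otimes>\<^bsub>G J\<^esub> x \<otimes>\<^bsub>G J\<^esub> inv\<^bsub>G J\<^esub> g \<in> closure_gens D J"
    using h(3-5) by blast
qed

lemma Ginc_N:
  assumes "finite J" "I \<subseteq> J" "card I \<le> D" "y \<in> H I"
  shows "Ginc I J y \<in> N D J"
proof -
  interpret group "G J" by (rule grp[OF assms(1)])
  have "Ginc I J y = \<one>\<^bsub>G J\<^esub> \<otimes>\<^bsub>G J\<^esub> Ginc I J y \<otimes>\<^bsub>G J\<^esub> inv\<^bsub>G J\<^esub> \<one>\<^bsub>G J\<^esub>"
    using Ginc_H[OF assms(1,2,4)] H_carrier[OF assms(1)] by simp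
  moreover have "Ginc I J y \<in> sub_at Ginc H J I" using assms(4) by (simp add: sub_at_def)
  ultimately have "Ginc I J y \<in> closure_gens D J" using assms(2,3) one_closed by blast
  then show ?thesis unfolding bounded_normal_closure_def by (rule generate.incl)
qed

text \<open>\<open>J\<close> itself is an admissible \<open>I\<close>. The map
  \<open>Ginc J J\<close> is known to be the identity only up to conjugacy, which normality of the
  closure absorbs.\<close>

lemma N_eq_H:
  assumes "finite J" "card J \<le> D"
  shows "N D J = H J"
proof
  show "H J \<subseteq> N D J"
  proof
    fix y assume y: "y \<in> H J"
    then have c: "y \<in> carrier (G J)" using H_carrier[OF assms(1)] by blast
    have "Ginc J J y \<in> N D J" using Ginc_N[OF assms(1) _ assms(2) y] by simp
    moreover have "conjugate (G J) (Ginc J J y) y"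
      using group.conjugate_trans[OF grp Ginc_Gf Gf_id] assms(1) c by blast
    ultimately show "y \<in> N D J"
      using group.conjugate_mem_normal[OF grp N_normal] assms(1) by blast
  qed
qed (rule N_le_H[OF assms(1)])

lemma N_mono:
  assumes "finite J" "D \<le> D'"
  shows "N D J \<subseteq> N D' J"
  unfolding bounded_normal_closure_def
  by (rule group.mono_generate[OF grp[OF assms(1)]]) (use assms(2) in \<open>blast intro: le_trans\<close>)

lemma Gf_N_gen:
  assumes f: "FI_inj J J' f" and I: "I \<subseteq> J" "card I \<le> D" and y: "y \<in> H I"
  shows "Gf J J' f (Ginc I J y) \<in> N D J'"
proof -
  have fin: "finite J" "finite J'" "finite I" using f I by (auto simp: FI_inj_def intro: finite_subset)
  interpret J': group "G J'" by (rule grp[OF fin(2)])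
  interpret f: group_hom "G J" "G J'" "Gf J J' f" by (rule Gf_group_hom[OF f])
  have yc: "y \<in> carrier (G I)" using H_carrier[OF fin(3) y] .
  define I' where "I' = f ` I"
  have fI: "FI_inj I I' f" and I': "I' \<subseteq> J'" "card I' \<le> D"
    using f I card_image_le[OF fin(3), of f] by (auto simp: FI_inj_def I'_def fin intro: inj_on_subset)
  have i: "FI_inj I' J' id" by (rule FI_inj_incl[OF fin(2) I'(1)])
  have 1: "conjugate (G J') (Gf J J' f (Ginc I J y)) (Gf J J' f (Gf I J id y))"
    by (rule f.conjugate_image[OF Ginc_Gf[OF fin(1) I(1) yc]])
  have 2: "conjugate (G J') (Gf J J' f (Gf I J id y)) (Gf I J' f y)"
    using J'.conjugate_sym[OF Gf_comp[OF FI_inj_incl[OF fin(1) I(1)] f yc]] by simp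
  have 3: "conjugate (G J') (Gf I J' f y) (Gf I' J' id (Gf I I' f y))"
    using Gf_comp[OF fI i yc] by simp
  have 4: "conjugate (G J') (Gf I' J' id (Gf I I' f y)) (Ginc I' J' (Gf I I' f y))"
    by (rule J'.conjugate_sym[OF Ginc_Gf[OF fin(2) I'(1) Gf_carrier[OF fI yc]]])
  have "conjugate (G J') (Gf J J' f (Ginc I J y)) (Ginc I' J' (Gf I I' f y))"
    by (rule J'.conjugate_trans[OF 1 J'.conjugate_trans[OF 2 J'.conjugate_trans[OF 3 4]]])
  moreover have "Ginc I' J' (Gf I I' f y) \<in> N D J'"
    by (rule Ginc_N[OF fin(2) I' Gf_H[OF fI y]])
  ultimately show ?thesis using J'.conjugate_mem_normal[OF N_normal[OF fin(2)]] by blast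
qed

lemma N_weak_FI: "normal_weak_FI_subgroup (N D) G Gf"
  unfolding normal_weak_FI_subgroup_def
proof (intro conjI allI impI)
  show "N D I \<lhd> G I" if "finite I" for I by (rule N_normal[OF that])
  fix J J' f assume f: "FI_inj J J' f"
  then have fin: "finite J" "finite J'" by (auto simp: FI_inj_def)
  interpret f: group_hom "G J" "G J'" "Gf J J' f" by (rule Gf_group_hom[OF f])
  have gens: "closure_gens D J \<subseteq> carrier (G J)"
    using closure_gens_H[OF fin(1)] H_carrier[OF fin(1)] by blast
  have "Gf J J' f ` N D J = generate (G J') (Gf J J' f ` closure_gens D J)"
    unfolding bounded_normal_closure_def by (rule f.generate_img[symmetric, OF gens])
  also have "\<dots> \<subseteq> N D J'"
  proof (rule f.H.generate_subgroup_incl[OF _ normal_imp_subgroup[OF N_normal[OF fin(2)]]])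
    show "Gf J J' f ` closure_gens D J \<subseteq> N D J'"
    proof
      fix z assume "z \<in> Gf J J' f ` closure_gens D J"
      then obtain x where x: "z = Gf J J' f x" "x \<in> closure_gens D J" by blast
      from x(2) obtain I y where y: "I \<subseteq> J" "card I \<le> D" "y \<in> H I"
        "\<exists>g\<in>carrier (G J). x = g \<otimes>\<^bsub>G J\<^esub> Ginc I J y \<otimes>\<^bsub>G J\<^esub> inv\<^bsub>G J\<^esub> g" by (rule closure_gensE)
      have "Ginc I J y \<in> carrier (G J)" by (rule H_carrier[OF fin(1) Ginc_H[OF fin(1) y(1,3)]])
      then have "conjugate (G J) x (Ginc I J y)" using y(4) by (simp add: conjugate_def)
      from f.H.conjugate_mem_normal[OF N_normal[OF fin(2)] f.conjugate_image[OF this]]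
      show "z \<in> N D J'" using x(1) Gf_N_gen[OF f y(1-3)] by simp
    qed
  qed
  finally show "Gf J J' f ` N D J \<subseteq> N D J'" .
qed

end

lemma boundedly_normally_generated_iff:
  "boundedly_normally_generated H G Ginc B \<longleftrightarrow>
    (\<forall>J. finite J \<longrightarrow> H J = bounded_normal_closure G Ginc H B J)"
  by (simp add: boundedly_normally_generated_def bounded_normal_closure_def)

section \<open>The induction step from H to H'\<close>

context weak_FI_normal
begin

text \<open>A commutator of an element coming from I1 with an element of H coming from I2 comes
from the union of I1 and I2, where it lies in H' by centrality; this gives the degree A + B.\<close>
lemma commutator_mem_closure:
  assumes H': "weak_FI_normal G Gf Ginc H'"
    and comm: "\<And>I. finite I \<Longrightarrow> commutator_subgroup (G I) (carrier (G I)) (H I) \<subseteq> H' I"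
    and A: "boundedly_generated G Ginc A" and B: "boundedly_normally_generated H G Ginc B"
    and J: "finite J" and g: "g \<in> carrier (G J)" and h: "h \<in> H J"
  shows "g \<otimes>\<^bsub>G J\<^esub> h \<otimes>\<^bsub>G J\<^esub> inv\<^bsub>G J\<^esub> g \<otimes>\<^bsub>G J\<^esub> inv\<^bsub>G J\<^esub> h
    \<in> bounded_normal_closure G Ginc H' (A + B) J"
proof -
  interpret H': weak_FI_normal G Gf Ginc H' by (rule H')
  define N where "N = H'.N (A + B) J"
  interpret group "G J" by (rule grp[OF J])
  have N: "N \<lhd> G J" unfolding N_def by (rule H'.N_normal[OF J])
  then have N_sub: "subgroup N (G J)" by (rule normal_imp_subgroup)
  define p where "p x = N #>\<^bsub>G J\<^esub> x" for x
  define Q where "Q = G J Mod N"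
  have p_hom: "p \<in> hom (G J) Q" unfolding p_def Q_def by (rule normal.r_coset_hom_Mod[OF N])
  interpret p: group_hom "G J" Q p
    using p_hom normal.factorgroup_is_group[OF N] by (simp add: Q_def group_hom_def group_hom_axioms_def is_group)
  have commute_iff: "p x \<otimes>\<^bsub>Q\<^esub> p y = p y \<otimes>\<^bsub>Q\<^esub> p x \<longleftrightarrow>
      x \<otimes>\<^bsub>G J\<^esub> y \<otimes>\<^bsub>G J\<^esub> inv\<^bsub>G J\<^esub> x \<otimes>\<^bsub>G J\<^esub> inv\<^bsub>G J\<^esub> y \<in> N"
    if "x \<in> carrier (G J)" "y \<in> carrier (G J)" for x y
  proof -
    have "p x \<otimes>\<^bsub>Q\<^esub> p y = p y \<otimes>\<^bsub>Q\<^esub> p x \<longleftrightarrow> p (x \<otimes>\<^bsub>G J\<^esub> y) = p (y \<otimes>\<^bsub>G J\<^esub> x)" using that by simp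
    also have "\<dots> \<longleftrightarrow> (x \<otimes>\<^bsub>G J\<^esub> y) \<otimes>\<^bsub>G J\<^esub> inv\<^bsub>G J\<^esub> (y \<otimes>\<^bsub>G J\<^esub> x) \<in> N"
      unfolding p_def using that by (intro rcos_eq_iff N_sub) auto
    finally show ?thesis using that by (simp add: inv_mult_group m_assoc)
  qed
  have base: "p (Ginc I1 J x) \<otimes>\<^bsub>Q\<^esub> p (Ginc I2 J y) = p (Ginc I2 J y) \<otimes>\<^bsub>Q\<^esub> p (Ginc I1 J x)"
    if I: "I1 \<subseteq> J" "card I1 \<le> A" "I2 \<subseteq> J" "card I2 \<le> B" and x: "x \<in> carrier (G I1)" and y: "y \<in> H I2"
    for I1 I2 x y
  proof -
    define I where "I = I1 \<union> I2"
    have IJ: "I \<subseteq> J" "I1 \<subseteq> I" "I2 \<subseteq> I" "card I \<le> A + B"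
      using I card_Un_le[of I1 I2] by (auto simp: I_def)
    have fin: "finite I" "finite I2" by (rule finite_subset[OF IJ(1) J], rule finite_subset[OF I(3) J])
    define x' y' where "x' = Ginc I1 I x" and "y' = Ginc I2 I y"
    have yc: "y \<in> carrier (G I2)" by (rule H_carrier[OF fin(2) y])
    have x': "x' \<in> carrier (G I)" unfolding x'_def by (rule Ginc_carrier[OF fin(1) IJ(2) x])
    have y': "y' \<in> H I" unfolding y'_def by (rule Ginc_H[OF fin(1) IJ(3) y])
    have y'c: "y' \<in> carrier (G I)" by (rule H_carrier[OF fin(1) y'])
    interpret i: group_hom "G I" "G J" "Ginc I J" by (rule Ginc_group_hom[OF J IJ(1)])
    define c where "c = x' \<otimes>\<^bsub>G I\<^esub> y' \<otimes>\<^bsub>G I\<^esub> inv\<^bsub>G I\<^esub> x' \<otimes>\<^bsub>G I\<^esub> inv\<^bsub>G I\<^esub> y'"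
    have "c \<in> commutator_subgroup (G I) (carrier (G I)) (H I)"
      unfolding c_def commutator_subgroup_def using x' y' by (intro generate.incl) blast
    then have "c \<in> H' I" using comm[OF fin(1)] by blast
    then have "Ginc I J c \<in> N" unfolding N_def by (rule H'.Ginc_N[OF J IJ(1,4)])
    \<comment> \<open>The strict law \<open>Ginc_Ginc\<close> is essential: if \<open>x'\<close> and
      \<open>y'\<close> reached the group at \<open>J\<close> only up to two unrelated conjugations,
      the image of their commutator would not be the commutator in question.\<close>
    moreover have "Ginc I J x' = Ginc I1 J x" "Ginc I J y' = Ginc I2 J y"
      unfolding x'_def y'_def using Ginc_Ginc J IJ x yc by simp_all
    ultimately show ?thesis
      using commute_iff[OF i.hom_closed[OF x'] i.hom_closed[OF y'c]] x' y'c by (simp add: c_def)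
  qed
  \<comment> \<open>Elements of \<open>H\<close> coming from at most \<open>B\<close> points are
    central in the quotient \<open>Q\<close>, because they commute with the images of the generators
    given by \<open>A\<close>.\<close>
  have central: "p g \<otimes>\<^bsub>Q\<^esub> p (Ginc I J y) = p (Ginc I J y) \<otimes>\<^bsub>Q\<^esub> p g"
    if I: "I \<subseteq> J" "card I \<le> B" "y \<in> H I" and g: "g \<in> carrier (G J)" for I y g
  proof (rule p.commute_generate)
    show "g \<in> generate (G J) (\<Union> {sub_at Ginc (\<lambda>I. carrier (G I)) J I | I. I \<subseteq> J \<and> card I \<le> A})"
      using A J g by (simp add: boundedly_generated_def)
    show "\<Union> {sub_at Ginc (\<lambda>I. carrier (G I)) J I | I. I \<subseteq> J \<and> card I \<le> A} \<subseteq> carrier (G J)"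
      using Ginc_carrier[OF J] by (auto simp: sub_at_def)
    show "p (Ginc I J y) \<in> carrier Q" using H_carrier[OF J Ginc_H[OF J I(1,3)]] by simp
    show "p s \<otimes>\<^bsub>Q\<^esub> p (Ginc I J y) = p (Ginc I J y) \<otimes>\<^bsub>Q\<^esub> p s"
      if "s \<in> \<Union> {sub_at Ginc (\<lambda>I. carrier (G I)) J I | I. I \<subseteq> J \<and> card I \<le> A}" for s
      using that base[OF _ _ I(1,2) _ I(3)] by (auto simp: sub_at_def)
  qed
  have "p h \<otimes>\<^bsub>Q\<^esub> p g = p g \<otimes>\<^bsub>Q\<^esub> p h"
  proof (rule p.commute_generate)
    show "h \<in> generate (G J) (closure_gens B J)"
      using B J h unfolding boundedly_normally_generated_iff bounded_normal_closure_def by blast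
    show "closure_gens B J \<subseteq> carrier (G J)"
      using closure_gens_H[OF J] H_carrier[OF J] by blast
    show "p g \<in> carrier Q" using g by simp
    fix s assume "s \<in> closure_gens B J"
    then obtain I y where y: "I \<subseteq> J" "card I \<le> B" "y \<in> H I"
      "\<exists>g\<in>carrier (G J). s = g \<otimes>\<^bsub>G J\<^esub> Ginc I J y \<otimes>\<^bsub>G J\<^esub> inv\<^bsub>G J\<^esub> g" by (rule closure_gensE)
    have yc: "Ginc I J y \<in> carrier (G J)" by (rule H_carrier[OF J Ginc_H[OF J y(1,3)]])
    from y(4) obtain k where k: "k \<in> carrier (G J)" "s = k \<otimes>\<^bsub>G J\<^esub> Ginc I J y \<otimes>\<^bsub>G J\<^esub> inv\<^bsub>G J\<^esub> k" by blast
    have "p s = p k \<otimes>\<^bsub>Q\<^esub> p (Ginc I J y) \<otimes>\<^bsub>Q\<^esub> inv\<^bsub>Q\<^esub> p k" using k yc by simp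
    \<comment> \<open>Conjugating a central element has no effect, so the normal generators of
      \<open>H\<close> have the same images in \<open>Q\<close> as the elements
      \<open>Ginc I J y\<close> and are central as well.\<close>
    also have "\<dots> = p (Ginc I J y) \<otimes>\<^bsub>Q\<^esub> (p k \<otimes>\<^bsub>Q\<^esub> inv\<^bsub>Q\<^esub> p k)"
      unfolding central[OF y(1-3) k(1)] using k(1) yc by (intro p.H.m_assoc) auto
    also have "\<dots> = p (Ginc I J y)" using k yc by simp
    finally show "p s \<otimes>\<^bsub>Q\<^esub> p g = p g \<otimes>\<^bsub>Q\<^esub> p s" using central[OF y(1-3) g] by simp
  qed
  then show ?thesis using commute_iff[OF g H_carrier[OF J h]] unfolding N_def by simp
qed

text \<open>Noetherianity yields generators of H'/N in bounded degree, and these lift to elements of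
  \<open>H'\<close> in the same degree. What is lost in lifting lies in N, which is normally
  generated in degree \<open>A + B\<close> by construction.\<close>

lemma boundedly_normally_generated_next:
  assumes H': "weak_FI_normal G Gf Ginc H'"
    and H'_le: "\<And>I. finite I \<Longrightarrow> H' I \<subseteq> H I"
    and comm: "\<And>I. finite I \<Longrightarrow> commutator_subgroup (G I) (carrier (G I)) (H I) \<subseteq> H' I"
    and fg: "\<And>I. finite I \<Longrightarrow> finitely_generated_group ((G I)\<lparr>carrier := H I\<rparr> Mod H' I)"
    and A: "boundedly_generated G Ginc A" and B: "boundedly_normally_generated H G Ginc B"
  shows "\<exists>D. boundedly_normally_generated H' G Ginc D"
proof -
  interpret H': weak_FI_normal G Gf Ginc H' by (rule H')
  interpret Nw: weak_FI_normal G Gf Ginc "H'.N (A + B)"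
    by (rule weak_FI_normal.intro[OF weak_FI_axioms weak_FI_normal_axioms.intro[OF H'.N_weak_FI]])
  define N where "N J = H'.N (A + B) J" for J
  define GH where "GH J = (G J)\<lparr>carrier := H J\<rparr>" for J
  define W where "W J = GH J Mod N J" for J
  define q where "q J x = N J #>\<^bsub>G J\<^esub> x" for J x
  have N_sub: "subgroup (N J) (G J)" if "finite J" for J
    unfolding N_def by (rule Nw.H_subgroup[OF that])
  have N_le_H': "N J \<subseteq> H' J" if "finite J" for J
    unfolding N_def by (rule H'.N_le_H[OF that])
  have N_le_H: "N J \<subseteq> H J" if "finite J" for J
    using N_le_H'[OF that] H'_le[OF that] by blast
  have N_GH: "N J \<lhd> GH J" if "finite J" for J
    unfolding GH_def
    by (rule group.normal_restrict_supergroup[OF grp[OF that] H_subgroup[OF that] _ N_le_H[OF that]])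
      (unfold N_def, rule Nw.H_normal[OF that])
  have GH_group: "group (GH J)" if "finite J" for J
    unfolding GH_def by (rule subgroup.subgroup_is_group[OF H_subgroup[OF that] grp[OF that]])
  have GH_carrier: "carrier (GH J) = H J" for J by (simp add: GH_def)
  have q_GH: "q J = (\<lambda>x. N J #>\<^bsub>GH J\<^esub> x)" for J
    by (simp add: q_def[abs_def] GH_def r_coset_def)
  have W_group: "group (W J)" if "finite J" for J
    unfolding W_def by (rule normal.factorgroup_is_group[OF N_GH[OF that]])
  have q_hom: "q J \<in> hom (GH J) (W J)" if "finite J" for J
    unfolding q_GH W_def by (rule normal.r_coset_hom_Mod[OF N_GH[OF that]])
  have q_group_hom: "group_hom (GH J) (W J) (q J)" if "finite J" for J
    using GH_group W_group q_hom that by (simp add: group_hom_def group_hom_axioms_def)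
  have W_carrier: "carrier (W J) = q J ` H J" for J
    by (simp add: W_def carrier_FactGroup q_GH GH_carrier)
  have q_mult: "q J x \<otimes>\<^bsub>W J\<^esub> q J y = q J (x \<otimes>\<^bsub>G J\<^esub> y)" if "finite J" "x \<in> H J" "y \<in> H J" for J x y
    using hom_mult[OF q_hom[OF that(1)]] that by (simp add: GH_def)
  have q_eq: "q J x = q J y \<longleftrightarrow> x \<otimes>\<^bsub>G J\<^esub> inv\<^bsub>G J\<^esub> y \<in> N J" if "finite J" "x \<in> H J" "y \<in> H J" for J x y
    unfolding q_def using group.rcos_eq_iff[OF grp N_sub] H_carrier that by blast
  have comm_N: "g \<otimes>\<^bsub>G J\<^esub> h \<otimes>\<^bsub>G J\<^esub> inv\<^bsub>G J\<^esub> g \<otimes>\<^bsub>G J\<^esub> inv\<^bsub>G J\<^esub> h \<in> N J"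
    if "finite J" "g \<in> carrier (G J)" "h \<in> H J" for J g h
    unfolding N_def by (rule commutator_mem_closure[OF H' comm A B that])
  \<comment> \<open>The transition from weak to honest: conjugating \<open>y\<close> by
    \<open>g\<close> multiplies it by a commutator lying in \<open>N J\<close>. Every law of
    \<open>G\<close> valid up to conjugacy therefore holds exactly in \<open>W\<close>.\<close>
  have q_conjugate: "q J x = q J y" if J: "finite J" and c: "conjugate (G J) x y" and y: "y \<in> H J" for J x y
  proof -
    obtain g where g: "g \<in> carrier (G J)" "x = g \<otimes>\<^bsub>G J\<^esub> y \<otimes>\<^bsub>G J\<^esub> inv\<^bsub>G J\<^esub> g"
      using c by (auto simp: conjugate_def)
    have "x \<in> H J" using group.conjugate_mem_normal[OF grp[OF J] H_normal[OF J] c] y by simp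
    then show ?thesis unfolding q_eq[OF J _ y] g(2) using comm_N[OF J g(1) y] by (simp add: q_eq[OF J] g y)
  qed
  have W_comm: "comm_group (W J)" if J: "finite J" for J
  proof (rule group.group_comm_groupI[OF W_group[OF J]])
    interpret group "G J" by (rule grp[OF J])
    fix \<alpha> \<beta> assume "\<alpha> \<in> carrier (W J)" "\<beta> \<in> carrier (W J)"
    then obtain x y where x: "\<alpha> = q J x" "x \<in> H J" and y: "\<beta> = q J y" "y \<in> H J"
      unfolding W_carrier by blast
    have c: "x \<in> carrier (G J)" "y \<in> carrier (G J)" using x y H_carrier[OF J] by blast+
    have xy: "x \<otimes>\<^bsub>G J\<^esub> y \<in> H J" "y \<otimes>\<^bsub>G J\<^esub> x \<in> H J"
      using subgroup.m_closed[OF H_subgroup[OF J]] x y by blast+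
    have "(x \<otimes>\<^bsub>G J\<^esub> y) \<otimes>\<^bsub>G J\<^esub> inv\<^bsub>G J\<^esub> (y \<otimes>\<^bsub>G J\<^esub> x) \<in> N J"
      using comm_N[OF J c(1) y(2)] c by (simp add: inv_mult_group m_assoc)
    then show "\<alpha> \<otimes>\<^bsub>W J\<^esub> \<beta> = \<beta> \<otimes>\<^bsub>W J\<^esub> \<alpha>"
      unfolding x(1) y(1) q_mult[OF J x(2) y(2)] q_mult[OF J y(2) x(2)] q_eq[OF J xy] .
  qed
  have ex_T: "\<exists>t. t \<in> hom (W I) (W J) \<and> (\<forall>x\<in>H I. t (q I x) = q J (Gf I J f x))" if f: "FI_inj I J f" for I J f
  proof -
    have fin: "finite I" "finite J" using f by (auto simp: FI_inj_def)
    interpret f: group_hom "G I" "G J" "Gf I J f" by (rule Gf_group_hom[OF f])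
    have hom: "(\<lambda>x. q J (Gf I J f x)) \<in> hom (GH I) (W J)"
    proof (rule homI)
      fix x y assume "x \<in> carrier (GH I)" "y \<in> carrier (GH I)"
      then have xy: "x \<in> H I" "y \<in> H I" by (simp_all add: GH_carrier)
      show "q J (Gf I J f x) \<in> carrier (W J)" using Gf_H[OF f xy(1)] by (simp add: W_carrier)
      show "q J (Gf I J f (x \<otimes>\<^bsub>GH I\<^esub> y)) = q J (Gf I J f x) \<otimes>\<^bsub>W J\<^esub> q J (Gf I J f y)"
        using xy H_carrier[OF fin(1)] q_mult[OF fin(2) Gf_H[OF f xy(1)] Gf_H[OF f xy(2)]]
        by (simp add: GH_def)
    qed
    have eq: "q J (Gf I J f x) = q J (Gf I J f y)"
      if "x \<in> carrier (GH I)" "y \<in> carrier (GH I)" "N I #>\<^bsub>GH I\<^esub> x = N I #>\<^bsub>GH I\<^esub> y" for x y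
    proof -
      have xy: "x \<in> H I" "y \<in> H I" using that by (simp_all add: GH_carrier)
      have "q I x = q I y" using that(3) by (simp add: q_GH)
      then have "x \<otimes>\<^bsub>G I\<^esub> inv\<^bsub>G I\<^esub> y \<in> N I" using q_eq[OF fin(1) xy] by simp
      then have "Gf I J f (x \<otimes>\<^bsub>G I\<^esub> inv\<^bsub>G I\<^esub> y) \<in> N J" unfolding N_def by (rule Nw.Gf_H[OF f])
      then show ?thesis
        using q_eq[OF fin(2) Gf_H[OF f xy(1)] Gf_H[OF f xy(2)]] xy H_carrier[OF fin(1)] by simp
    qed
    obtain t where "t \<in> hom (GH I Mod N I) (W J)"
      "\<And>x. x \<in> carrier (GH I) \<Longrightarrow> t (N I #>\<^bsub>GH I\<^esub> x) = q J (Gf I J f x)"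
      by (rule FactGroup_universal[OF hom N_GH[OF fin(1)] eq]) (assumption+, rule that)
    then show ?thesis by (intro exI[of _ t]) (simp add: W_def q_GH GH_carrier)
  qed
  \<comment> \<open>The choice is harmless: every element of \<open>W I\<close> has the form
    \<open>q I x\<close>, so the second condition fixes the values there.\<close>
  define T where "T I J f = (SOME t. t \<in> hom (W I) (W J) \<and> (\<forall>x\<in>H I. t (q I x) = q J (Gf I J f x)))" for I J f
  have T: "T I J f \<in> hom (W I) (W J) \<and> (\<forall>x\<in>H I. T I J f (q I x) = q J (Gf I J f x))" if "FI_inj I J f" for I J f
    unfolding T_def by (rule someI_ex[OF ex_T[OF that]])
  have T_hom: "T I J f \<in> hom (W I) (W J)" if "FI_inj I J f" for I J f
    using T[OF that] by simp
  have T_q: "T I J f (q I x) = q J (Gf I J f x)" if "FI_inj I J f" "x \<in> H I" for I J f x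
    using T[OF that(1)] that(2) by simp
  \<comment> \<open>The representative of the inclusion and the actual map \<open>Ginc I J\<close>
    are conjugate, hence induce the same map. This relates generation of the module to the subgroups
    \<open>sub_at\<close>.\<close>
  have T_incl: "T I J id (q I x) = q J (Ginc I J x)" if J: "finite J" "I \<subseteq> J" and x: "x \<in> H I" for I J x
  proof -
    have xc: "x \<in> carrier (G I)" by (rule H_carrier[OF finite_subset[OF J(2,1)] x])
    note i = FI_inj_incl[OF J]
    show ?thesis
      unfolding T_q[OF i x] by (rule q_conjugate[OF J(1) Ginc_Gf[OF J xc] Gf_H[OF i x], symmetric])
  qed
  have module: "fi_module W T"
    unfolding fi_module_def
  proof (intro conjI allI impI)
    show "comm_group (W I)" if "finite I" for I by (rule W_comm[OF that])
    show "T I J f \<in> hom (W I) (W J)" if "FI_inj I J f" for I J f by (rule T_hom[OF that])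
    show "T I J f \<alpha> = T I J f' \<alpha>" if f: "FI_inj I J f" and ff': "\<forall>i\<in>I. f i = f' i" and \<alpha>: "\<alpha> \<in> carrier (W I)" for I J f f' \<alpha>
    proof -
      have fin: "finite I" "finite J" using f by (auto simp: FI_inj_def)
      have f': "FI_inj I J f'" using f ff' by (auto simp: FI_inj_def cong: inj_on_cong image_cong)
      obtain x where x: "\<alpha> = q I x" "x \<in> H I" using \<alpha> unfolding W_carrier by blast
      show ?thesis
        unfolding x(1) T_q[OF f x(2)] T_q[OF f' x(2)]
        by (rule q_conjugate[OF fin(2) Gf_cong[OF f ff' H_carrier[OF fin(1) x(2)]] Gf_H[OF f' x(2)]])
    qed
    show "T I I id \<alpha> = \<alpha>" if I: "finite I" and \<alpha>: "\<alpha> \<in> carrier (W I)" for I \<alpha>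
    proof -
      obtain x where x: "\<alpha> = q I x" "x \<in> H I" using \<alpha> unfolding W_carrier by blast
      show ?thesis
        unfolding x(1) T_q[OF FI_inj_incl[OF I subset_refl] x(2)]
        by (rule q_conjugate[OF I Gf_id[OF I H_carrier[OF I x(2)]] x(2)])
    qed
    show "T I K (g \<circ> f) \<alpha> = T J K g (T I J f \<alpha>)"
      if f: "FI_inj I J f" and g: "FI_inj J K g" and \<alpha>: "\<alpha> \<in> carrier (W I)" for I J K f g \<alpha>
    proof -
      have fin: "finite I" "finite K" using f g by (auto simp: FI_inj_def)
      obtain x where x: "\<alpha> = q I x" "x \<in> H I" using \<alpha> unfolding W_carrier by blast
      note fx = Gf_H[OF f x(2)]
      show ?thesis
        unfolding x(1) T_q[OF f x(2)] T_q[OF g fx] T_q[OF FI_inj_comp[OF f g] x(2)]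
        by (rule q_conjugate[OF fin(2) Gf_comp[OF f g H_carrier[OF fin(1) x(2)]] Gf_H[OF g fx]])
    qed
  qed
  have gen: "carrier (W J) = generate (W J) (\<Union>{T I J id ` carrier (W I) | I. I \<subseteq> J \<and> card I \<le> B})"
    (is "_ = generate _ ?R") if J: "finite J" for J
  proof
    have R: "?R \<subseteq> carrier (W J)"
      using hom_in_carrier[OF T_hom[OF FI_inj_incl[OF J]]] by blast
    show "generate (W J) ?R \<subseteq> carrier (W J)" by (rule group.generate_incl[OF W_group[OF J] R])
    have gens: "closure_gens B J \<subseteq> carrier (GH J)" using closure_gens_H[OF J] by (simp add: GH_carrier)
    have H_gen: "H J = generate (GH J) (closure_gens B J)"
      using B J unfolding GH_def boundedly_normally_generated_iff bounded_normal_closure_def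
        group.generate_consistent[OF grp[OF J] closure_gens_H[OF J] H_subgroup[OF J]] by blast
    have "q J x \<in> generate (W J) ?R" if "x \<in> H J" for x
    proof (rule generate_mono_hom_image[OF GH_group[OF J] W_group[OF J] q_hom[OF J] gens _ R])
      show "x \<in> generate (GH J) (closure_gens B J)" using that H_gen by blast
      show "q J ` closure_gens B J \<subseteq> generate (W J) ?R"
      proof
        fix z assume "z \<in> q J ` closure_gens B J"
        then obtain s where s: "z = q J s" "s \<in> closure_gens B J" by blast
        from s(2) obtain I y where y: "I \<subseteq> J" "card I \<le> B" "y \<in> H I"
          "\<exists>g\<in>carrier (G J). s = g \<otimes>\<^bsub>G J\<^esub> Ginc I J y \<otimes>\<^bsub>G J\<^esub> inv\<^bsub>G J\<^esub> g" by (rule closure_gensE)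
        note yJ = Ginc_H[OF J y(1,3)]
        \<comment> \<open>Conjugates have equal classes, so normal generation of \<open>H\<close> in
          degree \<open>B\<close> becomes plain generation of the module in degree
          \<open>B\<close>.\<close>
        have "conjugate (G J) s (Ginc I J y)" using y(4) H_carrier[OF J yJ] by (simp add: conjugate_def)
        from q_conjugate[OF J this yJ] have "z = T I J id (q I y)"
          unfolding s(1) T_incl[OF J y(1,3)] .
        moreover have "q I y \<in> carrier (W I)" using y(3) by (simp add: W_carrier)
        ultimately have "z \<in> ?R" using y(1,2) by blast
        then show "z \<in> generate (W J) ?R" by (rule generate.incl)
      qed
    qed
    then show "carrier (W J) \<subseteq> generate (W J) ?R" unfolding W_carrier by blast
  qed
  have W_fg: "finitely_generated_group (W I)" if "finite I" "card I \<le> B" for I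
  proof -
    \<comment> \<open>Since \<open>B \<le> A + B\<close>, a set of at most \<open>B\<close> elements
      is within the bound that defines \<open>N\<close>, and finite rank of the filtration
      applies.\<close>
    have "N I = H' I" unfolding N_def by (rule H'.N_eq_H) (use that in auto)
    then show ?thesis using fg[OF that(1)] by (simp add: W_def GH_def)
  qed
  have sub_W: "subgroup (q J ` U) (W J)" if J: "finite J" and U: "subgroup U (G J)" "U \<subseteq> H J" for J U
  proof (rule group_hom.subgroup_img_is_subgroup[OF q_group_hom[OF J]])
    show "subgroup U (GH J)"
      unfolding GH_def by (rule group.subgroup_incl[OF grp[OF J] U(1) H_subgroup[OF J] U(2)])
  qed
  have "\<exists>D. \<forall>J. finite J \<longrightarrow>
    q J ` H' J \<subseteq> generate (W J) (\<Union>{T I J id ` q I ` H' I | I. I \<subseteq> J \<and> card I \<le> D})"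
  proof (rule fi_module_noetherian[OF module gen W_fg])
    show "subgroup (q J ` H' J) (W J)" if "finite J" for J
      by (rule sub_W[OF that H'.H_subgroup[OF that] H'_le[OF that]])
    show "T I J f ` q I ` H' I \<subseteq> q J ` H' J" if f: "FI_inj I J f" for I J f
    proof -
      have "finite I" using f by (simp add: FI_inj_def)
      then show ?thesis using T_q[OF f] H'.Gf_H[OF f] H'_le by (auto simp: subset_iff)
    qed
  qed auto
  then obtain D0 where D0: "\<And>J. finite J \<Longrightarrow>
    q J ` H' J \<subseteq> generate (W J) (\<Union>{T I J id ` q I ` H' I | I. I \<subseteq> J \<and> card I \<le> D0})" by blast
  \<comment> \<open>\<open>D0\<close> covers generators modulo \<open>N\<close>, and
    \<open>A + B\<close> makes the closure in degree \<open>D\<close> contain \<open>N\<close>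
    itself.\<close>
  define D where "D = max D0 (A + B)"
  have "H' J \<subseteq> H'.N D J" if J: "finite J" for J
  proof
    interpret group "G J" by (rule grp[OF J])
    fix x assume x: "x \<in> H' J"
    have ND: "subgroup (H'.N D J) (G J)" by (rule normal_imp_subgroup[OF H'.N_normal[OF J]])
    have ND_H: "H'.N D J \<subseteq> H J" using H'.N_le_H[OF J] H'_le[OF J] by blast
    have "generate (W J) (\<Union>{T I J id ` q I ` H' I | I. I \<subseteq> J \<and> card I \<le> D0}) \<subseteq> q J ` H'.N D J"
    proof (rule group.generate_subgroup_incl[OF W_group[OF J] _ sub_W[OF J ND ND_H]])
      have "T I J id (q I y) \<in> q J ` H'.N D J" if I: "I \<subseteq> J" "card I \<le> D0" and y: "y \<in> H' I" for I y
      proof -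
        have "y \<in> H I" using y H'_le[OF finite_subset[OF I(1) J]] by blast
        moreover have "Ginc I J y \<in> H'.N D J"
          by (rule H'.Ginc_N[OF J I(1) _ y]) (use I(2) in \<open>simp add: D_def\<close>)
        ultimately show ?thesis using T_incl[OF J I(1)] by simp
      qed
      then show "\<Union>{T I J id ` q I ` H' I | I. I \<subseteq> J \<and> card I \<le> D0} \<subseteq> q J ` H'.N D J" by blast
    qed
    then have "q J x \<in> q J ` H'.N D J" using D0[OF J] x by blast
    then obtain z where z: "z \<in> H'.N D J" "q J x = q J z" by blast
    have xH: "x \<in> H J" and zH: "z \<in> H J" using x z ND_H H'_le[OF J] by blast+
    have "x \<otimes>\<^bsub>G J\<^esub> inv\<^bsub>G J\<^esub> z \<in> N J" using z(2) q_eq[OF J xH zH] by simp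
    moreover have "N J \<subseteq> H'.N D J" unfolding N_def by (rule H'.N_mono[OF J]) (simp add: D_def)
    ultimately have "(x \<otimes>\<^bsub>G J\<^esub> inv\<^bsub>G J\<^esub> z) \<otimes>\<^bsub>G J\<^esub> z \<in> H'.N D J"
      using subgroup.m_closed[OF ND _ z(1)] by blast
    then show "x \<in> H'.N D J" using H_carrier[OF J xH] H_carrier[OF J zH] by (simp add: m_assoc)
  qed
  then have "boundedly_normally_generated H' G Ginc D"
    unfolding boundedly_normally_generated_iff using H'.N_le_H by blast
  then show ?thesis by blast
qed

end

section \<open>Induction along the filtration\<close>

theorem theoremG:
  fixes G :: "nat set \<Rightarrow> 'a monoid"
    and Gf :: "nat set \<Rightarrow> nat set \<Rightarrow> (nat \<Rightarrow> nat) \<Rightarrow> 'a \<Rightarrow> 'a"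
    and Ginc :: "nat set \<Rightarrow> nat set \<Rightarrow> 'a \<Rightarrow> 'a"
    and F :: "nat \<Rightarrow> nat set \<Rightarrow> 'a set"
  assumes "weak_FI_group G Gf Ginc"
    and "central_filtration F G Gf"
    and "finite_rank_filtration F G"
    and "\<exists>A. boundedly_generated G Ginc A"
  shows "\<forall>k \<ge> 1. \<exists>B. boundedly_normally_generated (F k) G Ginc B"
proof (intro allI impI)
  fix k :: nat
  assume "1 \<le> k"
  have F1: "\<And>I. finite I \<Longrightarrow> F 1 I = carrier (G I)"
    and F_normal: "\<And>k. k \<ge> 1 \<Longrightarrow> normal_weak_FI_subgroup (F k) G Gf"
    and F_le: "\<And>k I. k \<ge> 1 \<Longrightarrow> finite I \<Longrightarrow> F (Suc k) I \<subseteq> F k I"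
    and F_comm: "\<And>k I. k \<ge> 1 \<Longrightarrow> finite I \<Longrightarrow>
      commutator_subgroup (G I) (carrier (G I)) (F k I) \<subseteq> F (Suc k) I"
    using assms(2) unfolding central_filtration_def by simp_all
  have F: "weak_FI_normal G Gf Ginc (F k)" if "k \<ge> 1" for k
    using assms(1) F_normal[OF that]
    by (simp add: weak_FI_normal_def weak_FI_def weak_FI_normal_axioms_def)
  obtain A where A: "boundedly_generated G Ginc A" using assms(4) by blast
  from \<open>1 \<le> k\<close> show "\<exists>B. boundedly_normally_generated (F k) G Ginc B"
  \<comment> \<open>The induction starts at 1, since nothing is assumed about
    \<open>F 0\<close>.\<close>
  proof (induction k rule: dec_induct)
    case base
    interpret weak_FI_normal G Gf Ginc "F 1" by (rule F) simp
    \<comment> \<open>\<open>F 1\<close> is all of \<open>G\<close>, so ordinary generation in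
      degree \<open>A\<close> already gives normal generation in degree \<open>A\<close>.\<close>
    have "F 1 J \<subseteq> N A J" if J: "finite J" for J
    proof -
      have "\<Union> {sub_at Ginc (\<lambda>I. carrier (G I)) J I | I. I \<subseteq> J \<and> card I \<le> A} \<subseteq> N A J"
      proof -
        have "Ginc I J y \<in> N A J" if I: "I \<subseteq> J" "card I \<le> A" and y: "y \<in> carrier (G I)" for I y
          by (rule Ginc_N[OF J I]) (use y F1[OF finite_subset[OF I(1) J]] in simp)
        then show ?thesis unfolding sub_at_def by blast
      qed
      from group.generate_subgroup_incl[OF grp[OF J] this normal_imp_subgroup[OF N_normal[OF J]]]
      show ?thesis using A J unfolding F1[OF J] boundedly_generated_def by blast
    qed
    then have "boundedly_normally_generated (F 1) G Ginc A"
      unfolding boundedly_normally_generated_iff using N_le_H by blast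
    then show ?case by blast
  next
    case (step k)
    then obtain B where B: "boundedly_normally_generated (F k) G Ginc B" by blast
    interpret weak_FI_normal G Gf Ginc "F k" by (rule F[OF step.hyps(1)])
    show ?case
    proof (rule boundedly_normally_generated_next[OF F _ _ _ A B])
      show "finitely_generated_group ((G I)\<lparr>carrier := F k I\<rparr> Mod F (Suc k) I)" if "finite I" for I
        using assms(3) step.hyps(1) that by (simp add: finite_rank_filtration_def)
    qed (use step.hyps(1) F_le F_comm in auto)
  qed
qed

end
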